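(* Let $p$ be prime, let $H$ be a subgroup of $\mathbb{F}_p^\times$, and let $\chi\colon H\to\mathbb{C}^\times$ be a character. (i) If $\chi$ is nontrivial, then for any $H$-closed subsets $A$ and $B$ of $\mathbb{F}_p^\times$ with $|A|+|B|\geq p+|H|-1$, there is a $\chi$-symmetric $f\colon\mathbb{F}_p\to\mathbb{C}$ with $\operatorname{supp}(f)=A$ and $\operatorname{supp}(\widehat f)=B$. (ii) If $\chi$ is trivial and $A$ and $B$ are $H$-closed subsets of $\mathbb{F}_p$ with $$|A|+|B|\geq\begin{cases}p+2|H|-1 & \text{if $0$ is in neither $A$ nor $B$},\\ p+|H| & \text{if $0$ is in precisely one of $A$ or $B$},\\ p+1 & \text{if $0$ is in both $A$ and $B$},\end{cases}$$ then there is a $\chi$-symmetric $f\colon\mathbb{F}_p\to\mathbb{C}$ with $\operatorname{supp}(f)=A$ and $\operatorname{supp}(\widehat f)=B$.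
   Context: $\mathbb{F}_p=\mathbb{Z}/p\mathbb{Z}$. A character of $H$ is a group homomorphism $\chi\colon H\to\mathbb{C}^\times$; it is trivial if it is identically $1$. A function $f\colon\mathbb{F}_p\to\mathbb{C}$ is $\chi$-symmetric if $f(hx)=\chi(h)f(x)$ for every $h\in H$ and $x\in\mathbb{F}_p$. The Fourier transform of $f$ is $\widehat f\colon\mathbb{F}_p\to\mathbb{C}$, $\widehat f(a)=\sum_{b\in\mathbb{F}_p}f(b)\exp(-2\pi i ab/p)$. The support $\operatorname{supp}(f)$ is the set of points where $f$ is nonzero. A subset of $\mathbb{F}_p$ is $H$-closed if it is closed under multiplication by elements of $H$, i.e. it is a union of $H$-orbits (the orbits being $\{0\}$ and the cosets of $H$ in $\mathbb{F}_p^\times$). *)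

theory Defs
  imports
    Complex_Main
    "HOL-Algebra.Group"
    "Berlekamp_Zassenhaus.Finite_Field"
begin

text \<open>
  The field with \<open>p\<close> elements is the type \<open>'p mod_ring\<close> with \<open>'p\<close> of class
  \<open>prime_card\<close>, so that \<open>p\<close> is \<open>CARD('p)\<close>.
\<close>

definition mult_grp :: "'a::field monoid" where
  "mult_grp = \<lparr>carrier = UNIV - {0}, monoid.mult = (*), one = 1\<rparr>"

text \<open>The values of \<open>\<chi>\<close> outside \<open>H\<close> are irrelevant.\<close>

definition is_character :: "'p::prime_card mod_ring set \<Rightarrow> ('p mod_ring \<Rightarrow> complex) \<Rightarrow> bool" where
  "is_character H \<chi> \<longleftrightarrow> \<chi> \<in> hom (mult_grp\<lparr>carrier := H\<rparr>) mult_grp"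

definition trivial_character :: "'p::prime_card mod_ring set \<Rightarrow> ('p mod_ring \<Rightarrow> complex) \<Rightarrow> bool" where
  "trivial_character H \<chi> \<longleftrightarrow> (\<forall>h\<in>H. \<chi> h = 1)"

definition chi_symmetric ::
  "'p::prime_card mod_ring set \<Rightarrow> ('p mod_ring \<Rightarrow> complex) \<Rightarrow> ('p mod_ring \<Rightarrow> complex) \<Rightarrow> bool" where
  "chi_symmetric H \<chi> f \<longleftrightarrow> (\<forall>h\<in>H. \<forall>x. f (h * x) = \<chi> h * f x)"

text \<open>
  The exponential is \<open>p\<close>-periodic in the product \<open>a b\<close>, so the choice of representatives
  in \<open>{0..<p}\<close> made by \<open>to_int_mod_ring\<close> is immaterial.
\<close>

definition fourier :: "('p::prime_card mod_ring \<Rightarrow> complex) \<Rightarrow> 'p mod_ring \<Rightarrow> complex" where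
  "fourier f a = (\<Sum>b\<in>UNIV. f b *
     exp (- (2 * of_real pi * \<i> * of_int (to_int_mod_ring a * to_int_mod_ring b) / of_nat CARD('p))))"

definition supp :: "('a \<Rightarrow> complex) \<Rightarrow> 'a set" where
  "supp f = {x. f x \<noteq> 0}"

definition H_closed :: "'p::prime_card mod_ring set \<Rightarrow> 'p mod_ring set \<Rightarrow> bool" where
  "H_closed H A \<longleftrightarrow> (\<forall>h\<in>H. \<forall>a\<in>A. h * a \<in> A)"

end

theory Submission
  imports Defs
begin

text \<open>
  The support of a nonzero \<open>\<chi>\<close>-symmetric function and that of its Fourier transform together
  meet more orbits than there are orbits available. Granted this uncertainty principle, the
  statement is linear algebra: for orbit sets of the critical size, a nonzero solution of the
  underdetermined system exists and the uncertainty principle forces its supports to be exactly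
  as prescribed; in general a generic linear combination of such solutions works.

  The uncertainty principle comes from reduction modulo \<open>p\<close>. A subring \<open>V\<close> of \<open>\<complex>\<close>
  maximal among those not containing \<open>1/p\<close> is a valuation ring, and the \<open>p\<close>-th roots of unity are
  congruent to \<open>1\<close> modulo its nonunits. Scale \<open>f\<close> so that its values lie in \<open>V\<close> and one of them is \<open>1\<close>.
  If \<open>fourier f\<close> has \<open>N\<close> zeros, the generating polynomial of \<open>f\<close> is divisible by \<open>(t - 1) ^ N\<close> modulo
  nonunits, so \<open>\<Sum>x. f x * q x\<close> is a nonunit for every integer polynomial \<open>q\<close> of degree below \<open>N\<close>. A
  polynomial \<open>q\<close> that vanishes modulo \<open>p\<close> on the rest of the support then gives a contradiction if
  the supports are too small. For a nontrivial character the bound \<open>p + 1\<close> obtained in this way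
  suffices because the supports consist of full \<open>H\<close>-orbits; invariant functions vanishing at \<open>0\<close>
  need the bound \<open>p + card H\<close>, for which \<open>q\<close> vanishes on the support outside one orbit.
\<close>

section \<open>Valuation rings\<close>

definition subring_set :: "'a::field set \<Rightarrow> bool" where
  "subring_set S \<longleftrightarrow> 1 \<in> S \<and> (\<forall>x\<in>S. \<forall>y\<in>S. x - y \<in> S \<and> x * y \<in> S)"

lemma subring_set_ops:
  assumes "subring_set S"
  shows subring_one: "1 \<in> S"
    and subring_zero: "0 \<in> S"
    and subring_diff: "x \<in> S \<Longrightarrow> y \<in> S \<Longrightarrow> x - y \<in> S"
    and subring_mult: "x \<in> S \<Longrightarrow> y \<in> S \<Longrightarrow> x * y \<in> S"
    and subring_uminus: "x \<in> S \<Longrightarrow> - x \<in> S"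
    and subring_add: "x \<in> S \<Longrightarrow> y \<in> S \<Longrightarrow> x + y \<in> S"
proof -
  show 1: "1 \<in> S" using assms by (simp add: subring_set_def)
  show d: "\<And>x y. x \<in> S \<Longrightarrow> y \<in> S \<Longrightarrow> x - y \<in> S"
    and "x \<in> S \<Longrightarrow> y \<in> S \<Longrightarrow> x * y \<in> S" 
    using assms by (simp_all add: subring_set_def)
  show 0: "0 \<in> S" using d[OF 1 1] by simp
  show u: "\<And>x. x \<in> S \<Longrightarrow> - x \<in> S" using d[OF 0] by fastforce
  show "x \<in> S \<Longrightarrow> y \<in> S \<Longrightarrow> x + y \<in> S" using d[of x "- y"] u by auto
qed

lemma subring_power: "subring_set S \<Longrightarrow> x \<in> S \<Longrightarrow> x ^ k \<in> S"
  by (induction k) (auto intro: subring_one subring_mult)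

lemma subring_sum: "subring_set S \<Longrightarrow> (\<And>i. i \<in> I \<Longrightarrow> g i \<in> S) \<Longrightarrow> sum g I \<in> S"
  by (induction I rule: infinite_finite_induct) (auto intro: subring_zero subring_add)

lemma subring_of_nat: "subring_set S \<Longrightarrow> of_nat k \<in> S"
  by (induction k) (auto intro: subring_one subring_zero subring_add)

lemma subring_of_int: "subring_set S \<Longrightarrow> of_int k \<in> S"
  by (cases k) (auto intro!: subring_of_nat subring_uminus simp del: of_nat_Suc)

definition adjoin :: "'a::field set \<Rightarrow> 'a \<Rightarrow> 'a set" where
  "adjoin S x = {poly q x | q. \<forall>i. coeff q i \<in> S}"

lemma subring_set_adjoin:
  assumes "subring_set S"
  shows "subring_set (adjoin S x)"
  unfolding subring_set_def
proof (intro conjI ballI)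
  show "1 \<in> adjoin S x" unfolding adjoin_def
    by (rule CollectI, rule exI[of _ 1]) (auto simp: coeff_1 assms subring_one subring_zero)
  fix u v assume "u \<in> adjoin S x" "v \<in> adjoin S x"
  then obtain q r where q: "u = poly q x" "\<forall>i. coeff q i \<in> S" and r: "v = poly r x" "\<forall>i. coeff r i \<in> S"
    by (auto simp: adjoin_def)
  have "\<forall>i. coeff (q - r) i \<in> S" using q r assms by (auto intro: subring_diff)
  then show "u - v \<in> adjoin S x" unfolding adjoin_def q r
    by (intro CollectI exI[of _ "q - r"]) simp
  have "\<forall>i. coeff (q * r) i \<in> S" using q r assms by (auto simp: coeff_mult intro!: subring_sum subring_mult)
  then show "u * v \<in> adjoin S x" unfolding adjoin_def q r
    by (intro CollectI exI[of _ "q * r"]) simp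
qed

lemma adjoin_superset:
  assumes "subring_set S" shows "S \<subseteq> adjoin S x"
proof
  fix s assume "s \<in> S"
  then show "s \<in> adjoin S x" unfolding adjoin_def
    by (intro CollectI exI[of _ "[:s:]"]) (auto simp: coeff_pCons assms subring_zero split: nat.splits)
qed

lemma adjoin_generator:
  assumes "subring_set S" shows "x \<in> adjoin S x"
  unfolding adjoin_def
  by (intro CollectI exI[of _ "[:0, 1:]"]) (auto simp: coeff_pCons assms subring_zero subring_one split: nat.splits)

section \<open>A subring maximal without \<open>inverse c\<close> is a valuation ring\<close>

locale maximal_subring_avoiding =
  fixes V :: "'a::field set" and c :: 'a
  assumes subring: "subring_set V" and c_in: "c \<in> V" and c_nonzero: "c \<noteq> 0"
    and inverse_c_notin: "inverse c \<notin> V"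
    and maximal: "\<And>W. subring_set W \<Longrightarrow> V \<subseteq> W \<Longrightarrow> inverse c \<notin> W \<Longrightarrow> W = V"
begin

lemmas [intro] = subring_zero[OF subring] subring_one[OF subring] subring_add[OF subring]
  subring_diff[OF subring] subring_mult[OF subring] subring_uminus[OF subring]
  subring_sum[OF subring] subring_power[OF subring]

lemma no_inverse: "s \<in> V \<Longrightarrow> c * s \<noteq> 1"
  using inverse_c_notin by (metis inverse_unique)

text \<open>By maximality \<open>adjoin V x\<close> contains \<open>inverse c\<close>. The resulting
  relation is the certificate that all later arguments about \<open>x \<notin> V\<close> start
  from.\<close>

lemma adjoin_outside:
  assumes "x \<notin> V"
  obtains q where "\<And>i. coeff q i \<in> V" "c * poly q x = 1"
proof -
  have "inverse c \<in> adjoin V x"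
    using maximal[OF subring_set_adjoin[OF subring] adjoin_superset[OF subring]]
      adjoin_generator[OF subring, of x] assms by blast
  then show thesis using that c_nonzero unfolding adjoin_def by (auto simp: field_simps)
qed

lemma power_one_minus:
  assumes "r \<in> V" shows "\<exists>t\<in>V. (1 - c * r) ^ k = 1 - c * t"
proof (induction k)
  case 0 then show ?case by (intro bexI[of _ 0]) auto
next
  case (Suc k)
  then obtain t where t: "t \<in> V" "(1 - c * r) ^ k = 1 - c * t" by auto
  show ?case using assms c_in t(1)
    by (intro bexI[of _ "r + t - c * r * t"]) (auto simp: t(2) algebra_simps)
qed

text \<open>Were the inverse \<open>y\<close> outside \<open>V\<close>, a relation
  \<open>c * poly q y = 1\<close> multiplied by \<open>(1 - c * r) ^ degree q\<close> would put that
  power in \<open>c V\<close>. But the power is \<open>1\<close> modulo \<open>c V\<close>, so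
  \<open>c\<close> would be invertible in \<open>V\<close>.\<close>

lemma inverse_one_minus_in:
  assumes r: "r \<in> V" shows "inverse (1 - c * r) \<in> V"
proof (rule ccontr)
  let ?y = "inverse (1 - c * r)"
  assume "?y \<notin> V"
  then obtain q where q: "\<And>i. coeff q i \<in> V" "c * poly q ?y = 1" using adjoin_outside by metis
  let ?n = "degree q"
  obtain t where t: "t \<in> V" "(1 - c * r) ^ ?n = 1 - c * t" using power_one_minus[OF r] by blast
  have nz: "1 - c * r \<noteq> 0" using no_inverse[OF r] by auto
  define s where "s = (\<Sum>i\<le>?n. coeff q i * (1 - c * r) ^ (?n - i))"
  have s: "s \<in> V" unfolding s_def
    by (intro subring_sum[OF subring] subring_mult[OF subring] q(1) subring_power[OF subring]) (use r c_in in auto)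
  have "(1 - c * r) ^ ?n * poly q ?y = s"
    unfolding s_def poly_altdef sum_distrib_left
    by (rule sum.cong) (use nz in \<open>auto simp: field_simps power_diff power_inverse\<close>)
  then have "(1 - c * r) ^ ?n = c * s" using q(2) by (metis mult.commute mult.left_commute mult_1)
  then have "c * (s + t) = 1" using t by (simp add: algebra_simps)
  then show False using no_inverse s t by blast
qed

text \<open>
  The relation in \<open>inverse x\<close> is used to eliminate the leading term of the relation in \<open>x\<close>.
\<close>

lemma degree_descent:
  assumes q: "\<And>i. coeff q i \<in> V" "c * poly q x = 1"
    and r: "\<And>i. coeff r i \<in> V" "c * poly r (inverse x) = 1"
    and le: "degree r \<le> degree q" and x: "x \<noteq> 0"
  shows "\<exists>q'. (\<forall>i. coeff q' i \<in> V) \<and> c * poly q' x = 1 \<and> degree q' < degree q"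
proof -
  let ?n = "degree q" and ?m = "degree r"
  have n0: "?n > 0"
  proof (rule ccontr)
    assume "\<not> ?n > 0"
    then obtain a where "q = [:a:]" by (metis degree_eq_zeroE gr0I)
    then show False using q(1)[of 0] q(2) no_inverse by auto
  qed
  define v where "v = inverse (1 - c * coeff r 0)"
  have v: "v \<in> V" unfolding v_def by (rule inverse_one_minus_in[OF r(1)])
  have nz: "1 - c * coeff r 0 \<noteq> 0" using no_inverse[OF r(1)] by auto
  define a where "a = coeff q ?n"
  \<comment> \<open>By the relation in \<open>inverse x\<close> and the unit
    \<open>1 - c * coeff r 0\<close>, \<open>1\<close> is a combination of positive powers of
    \<open>inverse x\<close>. Multiplying it by \<open>a * x ^ ?n\<close> replaces the leading term
    by terms of degree \<open>?n - i\<close>; here \<open>?m \<le> ?n\<close> keeps the subtraction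
    from being truncated.\<close>
  define q' where "q' = (q - monom a ?n) + (\<Sum>i=1..?m. monom (c * v * a * coeff r i) (?n - i))"
  have aV: "a \<in> V" unfolding a_def by (rule q)
  have "1 = c * (coeff r 0 + (\<Sum>i=1..?m. coeff r i * inverse x ^ i))"
    using r(2) unfolding poly_altdef by (simp add: sum.atLeast1_atMost_eq sum.atMost_shift lessThan_Suc_atMost)
  then have "1 - c * coeff r 0 = c * (\<Sum>i=1..?m. coeff r i * inverse x ^ i)" by (simp add: algebra_simps)
  then have one: "1 = v * c * (\<Sum>i=1..?m. coeff r i * inverse x ^ i)" using nz unfolding v_def by (metis left_inverse mult.assoc)
  have "a * x ^ ?n = a * x ^ ?n * (v * c * (\<Sum>i=1..?m. coeff r i * inverse x ^ i))"
    using one by simp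
  also have "\<dots> = (\<Sum>i=1..?m. c * v * a * coeff r i * x ^ (?n - i))"
    unfolding sum_distrib_left
  proof (rule sum.cong)
    fix i assume "i \<in> {1..?m}"
    then have "i \<le> ?n" using le by auto
    then have "x ^ ?n * inverse x ^ i = x ^ (?n - i)" using x by (simp add: power_diff field_simps power_inverse)
    then show "a * x ^ ?n * (v * c * (coeff r i * inverse x ^ i)) = c * v * a * coeff r i * x ^ (?n - i)"
      by (metis (no_types, opaque_lifting) mult.assoc mult.commute)
  qed simp
  finally have "poly q' x = poly q x" unfolding q'_def by (simp add: poly_sum poly_monom)
  moreover have "coeff q' i \<in> V" for i
    unfolding q'_def coeff_add coeff_diff coeff_sum coeff_monom
    using q(1) r(1) aV v c_in by (intro subring_add[OF subring] subring_diff[OF subring] subring_sum[OF subring]) auto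
  moreover have "degree q' < ?n"
  proof (rule degree_lessI)
    show "q' \<noteq> 0 \<or> 0 < ?n" using n0 by simp
    show "\<forall>k\<ge>?n. coeff q' k = 0"
    proof (intro allI impI)
      fix k assume "?n \<le> k"
      then have "(\<Sum>i=1..?m. coeff (monom (c * v * a * coeff r i) (?n - i)) k) = 0"
        using n0 by (intro sum.neutral) auto
      then show "coeff q' k = 0" using \<open>?n \<le> k\<close> unfolding q'_def
        by (cases "k = ?n") (auto simp: coeff_sum a_def coeff_eq_0)
    qed
  qed
  ultimately show ?thesis using q(2) by metis
qed

text \<open>If both memberships fail, \<open>x\<close> and \<open>inverse x\<close> each satisfy a
  relation as in \<open>adjoin_outside\<close>. Choose both of minimal degree;
  \<open>degree_descent\<close> lowers the larger of the two degrees.\<close>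

lemma valuation_ring:
  assumes x: "x \<noteq> 0" shows "x \<in> V \<or> inverse x \<in> V"
proof (rule ccontr)
  assume "\<not> ?thesis"
  then have n: "x \<notin> V" "inverse x \<notin> V" by auto
  define W where "W x q \<longleftrightarrow> (\<forall>i. coeff q i \<in> V) \<and> c * poly q x = 1" for x q
  define q where "q = arg_min degree (W x)"
  define r where "r = arg_min degree (W (inverse x))"
  have ex: "\<exists>q. W x q" "\<exists>q. W (inverse x) q" unfolding W_def using n adjoin_outside by metis+
  have q: "W x q" "\<And>s. W x s \<Longrightarrow> degree q \<le> degree s" unfolding q_def using ex(1)
    by (meson arg_min_natI) (meson arg_min_nat_le)
  have r: "W (inverse x) r" "\<And>s. W (inverse x) s \<Longrightarrow> degree r \<le> degree s" unfolding r_def using ex(2)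
    by (meson arg_min_natI) (meson arg_min_nat_le)
  show False
  proof (cases "degree r \<le> degree q")
    case True
    then obtain s where "W x s" "degree s < degree q"
      using degree_descent[of q x r] q(1) r(1) x unfolding W_def by blast
    then show False using q(2) by fastforce
  next
    case False
    then obtain s where "W (inverse x) s" "degree s < degree r"
      using degree_descent[of r "inverse x" q] q(1) r(1) x unfolding W_def by auto
    then show False using r(2) by fastforce
  qed
qed

end

text \<open>Zorn's lemma applies because two elements of the union of a chain lie in a common
  member, so the union is again a subring.\<close>

lemma exists_maximal_subring_avoiding:
  assumes c: "c \<noteq> 0" and S: "subring_set S" "c \<in> S" "inverse c \<notin> S"
  shows "\<exists>V. maximal_subring_avoiding V c"
proof -
  define F where "F = {W. subring_set W \<and> S \<subseteq> W \<and> inverse c \<notin> W}"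
  have "\<exists>M\<in>F. \<forall>X\<in>F. M \<subseteq> X \<longrightarrow> X = M"
  proof (rule subset_Zorn_nonempty)
    show "F \<noteq> {}" using S unfolding F_def by auto
    fix C assume C: "C \<noteq> {}" "subset.chain F C"
    have sub: "W \<in> F" if "W \<in> C" for W using C(2) that unfolding subset.chain_def by auto
    have "subring_set (\<Union>C)"
      unfolding subring_set_def
    proof (intro conjI ballI)
      show "1 \<in> \<Union>C" using C(1) sub unfolding F_def by (auto intro: subring_one)
      fix x y assume "x \<in> \<Union>C" "y \<in> \<Union>C"
      then obtain X Y where "X \<in> C" "Y \<in> C" "x \<in> X" "y \<in> Y" by auto
      moreover have "X \<subseteq> Y \<or> Y \<subseteq> X" using C(2) \<open>X \<in> C\<close> \<open>Y \<in> C\<close> unfolding subset.chain_def by blast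
      ultimately obtain Z where "Z \<in> C" "x \<in> Z" "y \<in> Z" by blast
      moreover from this have "subring_set Z" using sub unfolding F_def by auto
      ultimately show "x - y \<in> \<Union>C" "x * y \<in> \<Union>C" by (auto intro: subring_diff subring_mult)
    qed
    then show "\<Union>C \<in> F" using C(1) sub unfolding F_def by auto
  qed
  then obtain V where V: "V \<in> F" "\<And>X. X \<in> F \<Longrightarrow> V \<subseteq> X \<Longrightarrow> X = V" by auto
  have "maximal_subring_avoiding V c"
    by unfold_locales (use V c S in \<open>auto simp: F_def\<close>)
  then show ?thesis ..
qed

section \<open>The ideal of nonunits and moments of polynomials\<close>

context maximal_subring_avoiding
begin

text \<open>This is the maximal ideal of \<open>V\<close>. Zero is listed separately because
  \<open>inverse 0 = 0\<close> lies in \<open>V\<close>.\<close>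

definition nonunits :: "'a set" where
  "nonunits = {x \<in> V. x = 0 \<or> inverse x \<notin> V}"

lemma zero_nonunits: "0 \<in> nonunits"
  by (auto simp: nonunits_def)

lemma one_notin_nonunits: "1 \<notin> nonunits"
  by (auto simp: nonunits_def)

lemma c_nonunits: "c \<in> nonunits"
  using c_in inverse_c_notin by (simp add: nonunits_def)

lemma nonunits_mult:
  assumes "a \<in> V" "x \<in> nonunits"
  shows "a * x \<in> nonunits"
proof (cases "a * x = 0")
  case False
  have "inverse (a * x) \<notin> V"
  proof
    assume "inverse (a * x) \<in> V"
    then have "a * inverse (a * x) \<in> V" using assms(1) by auto
    then show False using False assms(2) by (auto simp: nonunits_def field_simps)
  qed
  then show ?thesis using assms by (auto simp: nonunits_def)
qed (auto simp: zero_nonunits)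

text \<open>One of \<open>x / y\<close> and \<open>y / x\<close> lies in \<open>V\<close>, so the
  sum is a \<open>V\<close>-multiple of one of the two summands.\<close>

lemma nonunits_add:
  assumes x: "x \<in> nonunits" and y: "y \<in> nonunits"
  shows "x + y \<in> nonunits"
proof -
  have *: "u + w \<in> nonunits" if "u \<in> nonunits" "u \<noteq> 0" "w / u \<in> V" for u w
  proof -
    have "u + w = (1 + w / u) * u" using that by (simp add: field_simps)
    then show ?thesis using that by (metis nonunits_mult subring_add subring_one subring)
  qed
  show ?thesis
  proof (cases "x = 0 \<or> y = 0")
    case False
    then have "y / x \<in> V \<or> x / y \<in> V" using valuation_ring[of "y / x"] by simp
    then show ?thesis using *[of x y] *[of y x] x y False by (auto simp: add.commute)
  qed (use x y in auto)
qed

lemma nonunits_uminus: "x \<in> nonunits \<Longrightarrow> - x \<in> nonunits"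
  by (auto simp: nonunits_def) (metis minus_minus subring subring_uminus)

lemma nonunits_sum: "(\<And>i. i \<in> I \<Longrightarrow> g i \<in> nonunits) \<Longrightarrow> sum g I \<in> nonunits"
  by (induction I rule: infinite_finite_induct) (auto intro: zero_nonunits nonunits_add)

lemma nonunits_prime:
  assumes "x \<in> V" "y \<in> V" "x * y \<in> nonunits"
  shows "x \<in> nonunits \<or> y \<in> nonunits"
  using assms by (auto simp: nonunits_def)

lemma nonunits_power:
  assumes "x \<in> V" "x ^ k \<in> nonunits"
  shows "x \<in> nonunits"
  using assms(2)
proof (induction k)
  case 0 then show ?case by (simp add: one_notin_nonunits)
next
  case (Suc k)
  then show ?case using nonunits_prime[of x "x ^ k"] assms(1) by auto
qed

text \<open>Division by a monic linear factor, read from the top coefficient downwards: each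
  coefficient of \<open>Q\<close> is a coefficient of \<open>P\<close> plus \<open>z\<close> times
  the next coefficient of \<open>Q\<close>.\<close>

lemma coeff_linear_quotient_in:
  assumes P: "P = [:- z, 1:] * Q" "\<And>i. coeff P i \<in> V" and z: "z \<in> V"
  shows "coeff Q i \<in> V"
proof (induction "Suc (degree Q) - i" arbitrary: i)
  case 0
  then show ?case by (auto simp: coeff_eq_0)
next
  case (Suc k)
  have "coeff P (Suc i) = coeff Q i - z * coeff Q (Suc i)" by (simp add: P(1))
  moreover have "coeff Q (Suc i) \<in> V" using Suc by auto
  ultimately show ?case using P(2)[of "Suc i"] z
    by (metis diff_add_cancel subring subring_add subring_mult)
qed

text \<open>
  Modulo the ideal of nonunits, \<open>P\<close> is divisible by \<open>(t - 1) ^ card Z\<close>.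
\<close>

lemma power_moment_nonunits:
  assumes "finite Z" "\<And>i. coeff P i \<in> V" "degree P \<le> n"
    and "\<And>z. z \<in> Z \<Longrightarrow> poly P z = 0 \<and> z \<in> V \<and> 1 - z \<in> nonunits" "j < card Z"
  shows "(\<Sum>i\<le>n. coeff P i * of_nat i ^ j) \<in> nonunits"
  using assms
proof (induction Z arbitrary: P j rule: finite_induct)
  case empty
  then show ?case by simp
next
  case (insert z Z)
  have z: "poly P z = 0" "z \<in> V" "1 - z \<in> nonunits" using insert by auto
  obtain Q where Q: "P = [:- z, 1:] * Q" using z(1) by (auto simp: poly_eq_0_iff_dvd elim: dvdE)
  have QV: "coeff Q i \<in> V" for i by (rule coeff_linear_quotient_in[OF Q insert.prems(1) z(2)])
  \<comment> \<open>The vanishing at \<open>n\<close> allows the shifted sum below to run up to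
    \<open>n\<close> again.\<close>
  have dQ: "coeff Q n = 0" "degree Q \<le> n"
  proof -
    have "Q = 0 \<or> degree P = Suc (degree Q)"
      unfolding Q by (cases "Q = 0") (simp_all add: degree_mult_eq del: mult_pCons_left)
    then show "coeff Q n = 0" "degree Q \<le> n" using insert.prems(2) by (auto simp: coeff_eq_0)
  qed
  have IH: "(\<Sum>i\<le>n. coeff Q i * of_nat i ^ k) \<in> nonunits" if "k < card Z" for k
  proof (rule insert.IH[OF QV dQ(2) _ that])
    fix w assume w: "w \<in> Z"
    then have "w \<noteq> z" "poly P w = 0" using insert by auto
    then show "poly Q w = 0 \<and> w \<in> V \<and> 1 - w \<in> nonunits" using insert.prems(3) w by (auto simp: Q)
  qed
  \<comment> \<open>Since \<open>P = t Q - z Q\<close>, and the \<open>j\<close>-th moment of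
    \<open>t Q\<close> is a binomial combination of the moments \<open>?L k\<close> with
    \<open>k \<le> j\<close>, the two terms with \<open>?L j\<close> combine to
    \<open>?L j * (1 - z)\<close>. The others have \<open>k < j \<le> card Z\<close> and fall under
    the induction hypothesis.\<close>
  let ?L = "\<lambda>k. \<Sum>i\<le>n. coeff Q i * of_nat i ^ k"
  have "(\<Sum>i\<le>n. coeff P i * of_nat i ^ j)
      = (\<Sum>i\<le>n. coeff (pCons 0 Q) i * of_nat i ^ j) - z * ?L j"
    by (simp add: Q sum_subtractf sum_distrib_left algebra_simps)
  also have "(\<Sum>i\<le>n. coeff (pCons 0 Q) i * of_nat i ^ j) = (\<Sum>i<n. coeff Q i * of_nat (Suc i) ^ j)"
    by (subst sum.atMost_shift) simp
  also have "\<dots> = (\<Sum>i\<le>n. coeff Q i * of_nat (Suc i) ^ j)"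
    using dQ(1) by (simp flip: lessThan_Suc_atMost)
  also have "\<dots> = (\<Sum>i\<le>n. \<Sum>k\<le>j. of_nat (j choose k) * (coeff Q i * of_nat i ^ k))"
  proof (rule sum.cong)
    fix i
    have "of_nat (Suc i) ^ j = (\<Sum>k\<le>j. of_nat (j choose k) * of_nat i ^ k :: 'a)"
      using binomial_ring[of "of_nat i :: 'a" 1 j] by (simp add: add.commute)
    then show "coeff Q i * of_nat (Suc i) ^ j = (\<Sum>k\<le>j. of_nat (j choose k) * (coeff Q i * of_nat i ^ k))"
      by (simp add: sum_distrib_left algebra_simps)
  qed simp
  also have "\<dots> = (\<Sum>k\<le>j. of_nat (j choose k) * ?L k)"
    by (subst sum.swap) (simp add: sum_distrib_left)
  also have "\<dots> = (\<Sum>k<j. of_nat (j choose k) * ?L k) + ?L j"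
    by (simp flip: lessThan_Suc_atMost)
  finally have "(\<Sum>i\<le>n. coeff P i * of_nat i ^ j)
      = (\<Sum>k<j. of_nat (j choose k) * ?L k) + ?L j * (1 - z)" by (simp add: algebra_simps)
  moreover have "(\<Sum>k<j. of_nat (j choose k) * ?L k) \<in> nonunits"
    using insert.prems(4) insert.hyps
    by (intro nonunits_sum nonunits_mult IH subring_of_nat[OF subring]) auto
  moreover have "?L j * (1 - z) \<in> nonunits"
    by (intro nonunits_mult z subring_sum[OF subring] subring_mult[OF subring] QV
        subring_power[OF subring] subring_of_nat[OF subring])
  ultimately show ?case using nonunits_add by auto
qed

lemma poly_moment_nonunits:
  fixes q :: "int poly"
  assumes "finite Z" "\<And>i. coeff P i \<in> V" "degree P \<le> n"
    and "\<And>z. z \<in> Z \<Longrightarrow> poly P z = 0 \<and> z \<in> V \<and> 1 - z \<in> nonunits" "degree q < card Z"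
  shows "(\<Sum>i\<le>n. coeff P i * of_int (poly q (int i))) \<in> nonunits"
proof -
  have "(\<Sum>i\<le>n. coeff P i * of_int (poly q (int i)))
      = (\<Sum>i\<le>n. \<Sum>j\<le>degree q. of_int (coeff q j) * (coeff P i * of_nat i ^ j))"
    by (simp add: poly_altdef sum_distrib_left algebra_simps)
  also have "\<dots> = (\<Sum>j\<le>degree q. of_int (coeff q j) * (\<Sum>i\<le>n. coeff P i * of_nat i ^ j))"
    by (subst sum.swap) (simp add: sum_distrib_left)
  also have "\<dots> \<in> nonunits"
    using assms(5)
    by (intro nonunits_sum nonunits_mult subring_of_int[OF subring] power_moment_nonunits[OF assms(1-4)]) auto
  finally show ?thesis .
qed

text \<open>Divisibility in \<open>V\<close> is a total preorder on the nonzero field elements, so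
  one of finitely many values divides all the others. Dividing by it normalises \<open>f\<close> to
  values in \<open>V\<close>, one of them \<open>1\<close>.\<close>

lemma exists_dominant_value:
  assumes "finite X" "\<exists>x\<in>X. f x \<noteq> 0"
  shows "\<exists>x\<^sub>0\<in>X. f x\<^sub>0 \<noteq> 0 \<and> (\<forall>x\<in>X. f x / f x\<^sub>0 \<in> V)"
  using assms
proof (induction X rule: finite_induct)
  case (insert x X)
  show ?case
  proof (cases "\<exists>x\<in>X. f x \<noteq> 0")
    case False
    then show ?thesis using insert by (intro bexI[of _ x]) auto
  next
    case True
    then obtain x\<^sub>0 where x0: "x\<^sub>0 \<in> X" "f x\<^sub>0 \<noteq> 0" "\<And>y. y \<in> X \<Longrightarrow> f y / f x\<^sub>0 \<in> V"
      using insert by auto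
    show ?thesis
    proof (cases "f x / f x\<^sub>0 \<in> V")
      case True
      then show ?thesis using x0 by (intro bexI[of _ x\<^sub>0]) auto
    next
      case False
      then have nz: "f x \<noteq> 0" by auto
      then have inv: "f x\<^sub>0 / f x \<in> V" using valuation_ring[of "f x / f x\<^sub>0"] x0 False by simp
      have "f y / f x \<in> V" if "y \<in> X" for y
      proof -
        have "f y / f x = f y / f x\<^sub>0 * (f x\<^sub>0 / f x)" using x0 nz by simp
        then show ?thesis using x0(3)[OF that] inv by (metis subring subring_mult)
      qed
      then show ?thesis using nz by (intro bexI[of _ x]) auto
    qed
  qed
qed simp

end

section \<open>Residue characteristic \<open>p\<close> and the \<open>p\<close>-th roots of
  unity\<close>

locale residue_char_prime = maximal_subring_avoiding V "of_nat p"
  for V :: "'a::field_char_0 set" and p :: nat +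
  assumes prime: "prime p"
begin

text \<open>An integer prime to \<open>p\<close> generates \<open>1\<close> together with
  \<open>p\<close> by Bezout, and \<open>p\<close> is a nonunit. Congruences between integers modulo
  nonunits are thus congruences modulo \<open>p\<close>.\<close>

lemma of_int_nonunits_iff: "of_int k \<in> nonunits \<longleftrightarrow> int p dvd k"
proof
  assume "int p dvd k"
  then show "of_int k \<in> nonunits"
    using nonunits_mult[OF subring_of_int[OF subring] c_nonunits] by (auto simp: mult.commute elim!: dvdE)
next
  assume k: "of_int k \<in> nonunits"
  show "int p dvd k"
  proof (rule ccontr)
    assume "\<not> int p dvd k"
    then have "coprime (int p) k" using prime by (simp add: prime_imp_coprime)
    then obtain u v where "u * int p + v * k = 1" by (metis bezout_int coprime_imp_gcd_eq_1)
    then have "of_int u * of_nat p + of_int v * of_int k = (1 :: 'a)"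
      by (metis of_int_1 of_int_add of_int_mult of_int_of_nat_eq)
    moreover have "of_int u * of_nat p + of_int v * of_int k \<in> nonunits"
      by (intro nonunits_add nonunits_mult subring_of_int[OF subring] c_nonunits k)
    ultimately show False using one_notin_nonunits by simp
  qed
qed

text \<open>As \<open>z\<close> is a power of \<open>inverse z\<close>, it lies in \<open>V\<close>
  whichever of the two the valuation ring property provides.\<close>

lemma root_of_unity_in:
  assumes "z ^ p = 1"
  shows "z \<in> V"
proof -
  have "z \<noteq> 0" using assms prime by (auto simp: power_0_left)
  moreover have "z = inverse z ^ (p - 1)"
    using assms prime_gt_0_nat[OF prime] \<open>z \<noteq> 0\<close>
    by (cases p) (auto simp: power_inverse field_simps)
  ultimately show ?thesis using valuation_ring[of z] by (metis subring subring_power)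
qed

text \<open>The binomial theorem applied to \<open>((1 - z) + z) ^ p\<close> shows that \<open>p\<close> divides \<open>(1 - z) ^ p\<close>.\<close>

lemma one_minus_root_of_unity_nonunits:
  assumes "z ^ p = 1"
  shows "1 - z \<in> nonunits"
proof (rule nonunits_power)
  have z: "z \<in> V" by (rule root_of_unity_in[OF assms])
  then show V: "1 - z \<in> V" by auto
  obtain m where m: "p = Suc m" using prime_gt_0_nat[OF prime] by (cases p) auto
  let ?t = "\<lambda>k. of_nat (p choose k) * (1 - z) ^ k * z ^ (p - k)"
  have "1 = (\<Sum>k\<le>p. ?t k)" using binomial_ring[of "1 - z" z p] by simp
  also have "\<dots> = (\<Sum>k<p. ?t k) + (1 - z) ^ p" by (simp flip: lessThan_Suc_atMost)
  also have "(\<Sum>k<p. ?t k) = 1 + (\<Sum>k\<in>{0<..<p}. ?t k)"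
  proof -
    have "{..<p} = insert 0 {0<..<p}" using m by auto
    then show ?thesis using assms by simp
  qed
  finally have eq: "(1 - z) ^ p = - (\<Sum>k\<in>{0<..<p}. ?t k)" by (simp add: algebra_simps eq_neg_iff_add_eq_0)
  have "?t k \<in> nonunits" if "k \<in> {0<..<p}" for k
  proof -
    have "p dvd (p choose k)" using prime that by (intro dvd_choose_prime) auto
    then have "of_nat (p choose k) \<in> nonunits" using of_int_nonunits_iff[of "int (p choose k)"] by simp
    then have "((1 - z) ^ k * z ^ (p - k)) * of_nat (p choose k) \<in> nonunits"
      using V z by (intro nonunits_mult subring_mult[OF subring] subring_power[OF subring])
    then show ?thesis by (simp add: mult_ac)
  qed
  then show "(1 - z) ^ p \<in> nonunits" unfolding eq by (intro nonunits_uminus nonunits_sum)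
qed

end

text \<open>The ring of integers contains \<open>p\<close> but not its inverse, so it can be
  enlarged to a maximal such subring.\<close>

lemma exists_residue_char_prime:
  assumes "prime p"
  shows "\<exists>V :: 'a::field_char_0 set. residue_char_prime V p"
proof -
  have "inverse (of_nat p) \<notin> (\<int> :: 'a set)"
  proof
    assume "inverse (of_nat p) \<in> (\<int> :: 'a set)"
    then obtain k where "inverse (of_nat p :: 'a) = of_int k" by (auto elim: Ints_cases)
    then have "of_int (int p * k) = (1 :: 'a)" using prime_gt_0_nat[OF assms] by (metis of_int_mult of_int_of_nat_eq of_nat_0_eq_iff order_less_irrefl right_inverse)
    then have "int p * k = 1" by (simp only: of_int_eq_1_iff)
    then show False using prime_gt_1_nat[OF assms] by (auto simp: zmult_eq_1_iff)
  qed
  moreover have "subring_set (\<int> :: 'a set)" by (auto simp: subring_set_def)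
  ultimately obtain V :: "'a set" where "maximal_subring_avoiding V (of_nat p)"
    using exists_maximal_subring_avoiding[of "of_nat p :: 'a" \<int>] prime_gt_0_nat[OF assms] by auto
  then show ?thesis using assms unfolding residue_char_prime_def residue_char_prime_axioms_def by blast
qed

section \<open>Uncertainty principles\<close>

definition twiddle :: "'p::prime_card mod_ring \<Rightarrow> complex" where
  "twiddle a = exp (- (2 * of_real pi * \<i> * of_int (to_int_mod_ring a) / of_nat CARD('p)))"

lemma to_int_mod_ring_bounds:
  "0 \<le> to_int_mod_ring (x :: 'p::prime_card mod_ring)" "to_int_mod_ring x < int CARD('p)"
  using range_to_int_mod_ring[where 'a='p] rangeI[of to_int_mod_ring x] by auto

lemma of_int_to_int_mod_ring: "of_int (to_int_mod_ring x) = (x :: 'p::prime_card mod_ring)"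
  by (simp add: of_int_of_int_mod_ring)

lemma of_int_mod_ring_eq_0_iff: "of_int k = (0 :: 'p::prime_card mod_ring) \<longleftrightarrow> int CARD('p) dvd k"
  by (simp add: of_int_eq_0_iff_char_dvd)

text \<open>Up to conjugation these are the roots of unity enumerated by
  \<open>bij_betw_roots_unity\<close>, which yields both their distinctness and their order.\<close>

lemma twiddle_cis: "twiddle (a :: 'p::prime_card mod_ring)
    = cnj (cis (2 * pi * real (nat (to_int_mod_ring a)) / real CARD('p)))"
  unfolding cis_cnj unfolding twiddle_def cis_conv_exp by (simp add: to_int_mod_ring_bounds mult_ac)

lemma inj_twiddle: "inj (twiddle :: 'p::prime_card mod_ring \<Rightarrow> complex)"
proof (rule injI)
  fix a b :: "'p mod_ring"
  assume "twiddle a = twiddle b"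
  then have "cis (2 * pi * real (nat (to_int_mod_ring a)) / real CARD('p))
      = cis (2 * pi * real (nat (to_int_mod_ring b)) / real CARD('p))"
    unfolding twiddle_cis by (simp only: complex_cnj_cancel_iff)
  moreover have "nat (to_int_mod_ring a) \<in> {..<CARD('p)}" "nat (to_int_mod_ring b) \<in> {..<CARD('p)}"
    using to_int_mod_ring_bounds[of a] to_int_mod_ring_bounds[of b] by auto
  ultimately have "nat (to_int_mod_ring a) = nat (to_int_mod_ring b)"
    by (rule inj_onD[OF bij_betw_imp_inj_on[OF bij_betw_roots_unity[of "CARD('p)"]], rotated 1]) simp
  then have "to_int_mod_ring a = to_int_mod_ring b"
    using to_int_mod_ring_bounds(1)[of a] to_int_mod_ring_bounds(1)[of b] by linarith
  then show "a = b" by (metis of_int_to_int_mod_ring)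
qed

lemma twiddle_power_card: "twiddle (a :: 'p::prime_card mod_ring) ^ CARD('p) = 1"
proof -
  have "nat (to_int_mod_ring a) \<in> {..<CARD('p)}" using to_int_mod_ring_bounds[of a] by auto
  then have "cis (2 * pi * real (nat (to_int_mod_ring a)) / real CARD('p)) ^ CARD('p) = 1"
    using bij_betwE[OF bij_betw_roots_unity[OF zero_less_card_finite[where 'a='p]]] by blast
  then show ?thesis unfolding twiddle_cis by (simp only: complex_cnj_power[symmetric] complex_cnj_one)
qed

definition generating_poly :: "('p::prime_card mod_ring \<Rightarrow> complex) \<Rightarrow> complex poly" where
  "generating_poly f = (\<Sum>b\<in>UNIV. monom (f b) (nat (to_int_mod_ring b)))"

lemma fourier_conv_poly:
  fixes f :: "'p::prime_card mod_ring \<Rightarrow> complex"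
  shows "fourier f a = poly (generating_poly f) (twiddle a)"
proof -
  have "exp (- (2 * of_real pi * \<i> * of_int (to_int_mod_ring a * to_int_mod_ring b) / of_nat CARD('p)))
      = twiddle a ^ nat (to_int_mod_ring b)" for b :: "'p mod_ring"
    unfolding twiddle_def exp_of_nat_mult[symmetric]
    by (simp add: to_int_mod_ring_bounds of_nat_nat mult_ac)
  then show ?thesis by (simp add: fourier_def generating_poly_def poly_sum poly_monom)
qed

lemma degree_generating_poly: "degree (generating_poly (f :: 'p::prime_card mod_ring \<Rightarrow> complex)) \<le> CARD('p)"
  unfolding generating_poly_def
proof (rule degree_sum_le)
  fix b :: "'p mod_ring"
  have "nat (to_int_mod_ring b) \<le> CARD('p)" using to_int_mod_ring_bounds(2)[of b] by linarith
  then show "degree (monom (f b) (nat (to_int_mod_ring b))) \<le> CARD('p)"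
    using degree_monom_le order_trans by blast
qed simp

lemma sum_coeff_generating_poly:
  fixes f :: "'p::prime_card mod_ring \<Rightarrow> complex"
  shows "(\<Sum>i\<le>CARD('p). coeff (generating_poly f) i * g (int i)) = (\<Sum>b\<in>UNIV. f b * g (to_int_mod_ring b))"
proof -
  have "(\<Sum>i\<le>CARD('p). coeff (generating_poly f) i * g (int i))
      = (\<Sum>i\<le>CARD('p). \<Sum>b\<in>UNIV. if i = nat (to_int_mod_ring b) then f b * g (int i) else 0)"
    unfolding generating_poly_def coeff_sum sum_distrib_right
    by (intro sum.cong refl) auto
  also have "\<dots> = (\<Sum>b\<in>UNIV. \<Sum>i\<le>CARD('p). if i = nat (to_int_mod_ring b) then f b * g (int i) else 0)"
    by (rule sum.swap)
  also have "\<dots> = (\<Sum>b\<in>UNIV. f b * g (to_int_mod_ring b))"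
  proof (rule sum.cong)
    fix b :: "'p mod_ring"
    have "nat (to_int_mod_ring b) \<le> CARD('p)" using to_int_mod_ring_bounds(2)[of b] by linarith
    then show "(\<Sum>i\<le>CARD('p). if i = nat (to_int_mod_ring b) then f b * g (int i) else 0)
        = f b * g (to_int_mod_ring b)" by (simp add: to_int_mod_ring_bounds(1))
  qed simp
  finally show ?thesis .
qed

text \<open>Zeros of \<open>fourier g\<close> are distinct roots of the generating polynomial among
  the \<open>p\<close>-th roots of unity, all congruent to \<open>1\<close>. Hence its moments
  against polynomials of degree below the number of zeros are nonunits.\<close>

lemma fourier_moment_nonunits:
  fixes g :: "'p::prime_card mod_ring \<Rightarrow> complex" and q :: "int poly" and V :: "complex set"
  assumes V: "residue_char_prime V CARD('p)"
    and g: "\<And>x. g x \<in> V" and q: "degree q < card {a. fourier g a = 0}"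
  shows "(\<Sum>x\<in>UNIV. g x * of_int (poly q (to_int_mod_ring x))) \<in> maximal_subring_avoiding.nonunits V"
proof -
  interpret V: residue_char_prime V "CARD('p)" by (rule V)
  have inV: "coeff (generating_poly g) i \<in> V" for i
    unfolding generating_poly_def coeff_sum coeff_monom
    by (intro subring_sum[OF V.subring]) (auto simp: g subring_zero[OF V.subring])
  have "(\<Sum>i\<le>CARD('p). coeff (generating_poly g) i * of_int (poly q (int i))) \<in> V.nonunits"
  proof (rule V.poly_moment_nonunits[OF _ inV degree_generating_poly, of "twiddle ` {a. fourier g a = 0}"])
    show "degree q < card (twiddle ` {a. fourier g a = 0})"
      using q by (subst card_image) (auto intro: inj_on_subset[OF inj_twiddle])
    fix z assume "z \<in> twiddle ` {a. fourier g a = 0}"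
    then show "poly (generating_poly g) z = 0 \<and> z \<in> V \<and> 1 - z \<in> V.nonunits"
      by (auto simp: fourier_conv_poly twiddle_power_card
          intro: V.root_of_unity_in V.one_minus_root_of_unity_nonunits)
  qed simp
  then show ?thesis by (simp add: sum_coeff_generating_poly[where g="\<lambda>i. of_int (poly q i)"])
qed

section \<open>Lower bounds for the sizes of the two supports\<close>

lemma fourier_cmult: "fourier (\<lambda>x. c * f x) a = c * fourier f a"
  by (simp add: fourier_def sum_distrib_left mult.assoc)

text \<open>An integer lift of the monic polynomial over the prime field with simple roots exactly
  at \<open>Y\<close>; on representatives its values are divisible by \<open>p\<close> exactly at
  the points of \<open>Y\<close>.\<close>

definition root_poly :: "'p::prime_card mod_ring set \<Rightarrow> int poly" where
  "root_poly Y = (\<Prod>y\<in>Y. [:- to_int_mod_ring y, 1:])"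

lemma degree_root_poly: "degree (root_poly Y) = card Y"
  unfolding root_poly_def by (subst degree_prod_eq_sum_degree) auto

lemma of_int_poly_root_poly:
  "of_int (poly (root_poly Y) (to_int_mod_ring x)) = (\<Prod>y\<in>Y. x - y :: 'p::prime_card mod_ring)"
  by (simp add: root_poly_def poly_prod of_int_to_int_mod_ring)

lemma subgroup_mult_grpD:
  assumes "subgroup H (mult_grp :: 'a::field monoid)"
  shows "1 \<in> H" "0 \<notin> H" "g \<in> H \<Longrightarrow> h \<in> H \<Longrightarrow> g * h \<in> H" "h \<in> H \<Longrightarrow> inverse h \<in> H"
proof -
  interpret subgroup H "mult_grp :: 'a monoid" by (rule assms)
  show "1 \<in> H" using one_closed by (simp add: mult_grp_def)
  show z: "0 \<notin> H" using subset by (auto simp: mult_grp_def)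
  show "g \<in> H \<Longrightarrow> h \<in> H \<Longrightarrow> g * h \<in> H" using m_closed by (simp add: mult_grp_def)
  assume h: "h \<in> H"
  then have "h \<noteq> 0" using z by auto
  interpret G: group "mult_grp :: 'a monoid"
    by (rule groupI) (auto simp: mult_grp_def intro!: bexI[of _ "inverse _"])
  have "inv\<^bsub>mult_grp\<^esub> h = inverse h"
    by (rule G.inv_equality) (use \<open>h \<noteq> 0\<close> in \<open>auto simp: mult_grp_def\<close>)
  then show "inverse h \<in> H" using m_inv_closed[OF h] by simp
qed

text \<open>
  Taking the residue of a suitable moment of \<open>f\<close> at a point \<open>x\<^sub>0\<close> where \<open>f\<close> is dominant
  leaves \<open>card H * (\<Prod>y\<in>Y. x\<^sub>0 - y)\<close>, where \<open>Y\<close> is the support of \<open>f\<close> without the orbit of \<open>x\<^sub>0\<close>.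
\<close>

lemma uncertainty_invariant:
  fixes f :: "'p::prime_card mod_ring \<Rightarrow> complex"
  assumes H: "subgroup H mult_grp" and inv: "\<And>h x. h \<in> H \<Longrightarrow> f (h * x) = f x"
    and f: "f x \<noteq> 0" and free: "f 0 = 0 \<or> H = {1}"
  shows "card (supp f) + card (supp (fourier f)) \<ge> CARD('p) + card H"
proof (rule ccontr)
  assume less: "\<not> ?thesis"
  note H = subgroup_mult_grpD[OF H]
  obtain V :: "complex set" where "residue_char_prime V CARD('p)"
    using exists_residue_char_prime[OF prime_card] by blast
  then interpret V: residue_char_prime V "CARD('p)" .
  obtain x\<^sub>0 where x0: "f x\<^sub>0 \<noteq> 0" "\<And>x. f x / f x\<^sub>0 \<in> V"
    using V.exists_dominant_value[of UNIV f] f by auto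
  define g where "g x = inverse (f x\<^sub>0) * f x" for x
  have gV: "g x \<in> V" for x using x0(2)[of x] by (simp add: g_def field_simps)
  define Or where "Or = (\<lambda>h. h * x\<^sub>0) ` H"
  define Y where "Y = supp f - Or"
  \<comment> \<open>In either case the orbit of \<open>x\<^sub>0\<close> has exactly
    \<open>card H\<close> elements.\<close>
  have x0': "x\<^sub>0 \<noteq> 0 \<or> H = {1}" using x0(1) free by auto
  have inj: "inj_on (\<lambda>h. h * x\<^sub>0) H" using x0' by (auto simp: inj_on_def)
  have card_Or: "card Or = card H" unfolding Or_def by (rule card_image[OF inj])
  have Or_sub: "Or \<subseteq> supp f" using x0 inv by (auto simp: Or_def supp_def)
  have "card Y = card (supp f) - card H"
    unfolding Y_def using Or_sub by (simp add: card_Diff_subset card_Or)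
  moreover have "card {a. fourier g a = 0} = CARD('p) - card (supp (fourier f))"
  proof -
    have "{a. fourier g a = 0} = - supp (fourier f)"
      using x0(1) by (auto simp: g_def[abs_def] fourier_cmult supp_def)
    then show ?thesis by (simp add: Compl_eq_Diff_UNIV card_Diff_subset)
  qed
  moreover have "card H \<le> card (supp f)" using card_mono[OF _ Or_sub] card_Or by simp
  \<comment> \<open>The assumed failure of the bound says precisely that \<open>Y\<close> has fewer
    points than the transform has zeros.\<close>
  ultimately have deg: "degree (root_poly Y) < card {a. fourier g a = 0}"
    unfolding degree_root_poly using less by linarith
  let ?q = "\<lambda>x. poly (root_poly Y) (to_int_mod_ring x)"
  have residue: "of_int k \<in> V.nonunits \<longleftrightarrow> of_int k = (0 :: 'p mod_ring)" for k
    by (simp add: V.of_int_nonunits_iff of_int_mod_ring_eq_0_iff)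
  have "(\<Sum>x\<in>UNIV. g x * of_int (?q x)) \<in> V.nonunits"
    by (rule fourier_moment_nonunits[OF _ gV deg]) unfold_locales
  also have "(\<Sum>x\<in>UNIV. g x * of_int (?q x))
      = (\<Sum>x\<in>- Or. g x * of_int (?q x)) + (\<Sum>x\<in>Or. g x * of_int (?q x))"
    by (subst sum.subset_diff[of Or]) (auto simp: Compl_eq_Diff_UNIV)
  also have "(\<Sum>x\<in>Or. g x * of_int (?q x)) = of_int (\<Sum>x\<in>Or. ?q x)"
    unfolding of_int_sum by (rule sum.cong) (use x0 inv in \<open>auto simp: Or_def g_def\<close>)
  finally have total: "(\<Sum>x\<in>- Or. g x * of_int (?q x)) + of_int (\<Sum>x\<in>Or. ?q x) \<in> V.nonunits" .
  have outside: "(\<Sum>x\<in>- Or. g x * of_int (?q x)) \<in> V.nonunits"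
  proof (rule V.nonunits_sum)
    fix x assume x: "x \<in> - Or"
    show "g x * of_int (?q x) \<in> V.nonunits"
    proof (cases "f x = 0")
      case True
      then show ?thesis by (simp add: g_def V.zero_nonunits)
    next
      case False
      then have "x \<in> Y" using x by (auto simp: Y_def supp_def)
      then have "of_int (?q x) = (0 :: 'p mod_ring)"
        unfolding of_int_poly_root_poly by (intro prod_zero) auto
      then show ?thesis using residue gV by (intro V.nonunits_mult) auto
    qed
  qed
  have "of_int (\<Sum>x\<in>Or. ?q x) \<in> V.nonunits"
    using V.nonunits_add[OF total V.nonunits_uminus[OF outside]] by simp
  then have "of_int (\<Sum>x\<in>Or. ?q x) = (0 :: 'p mod_ring)" by (simp only: residue)
  then have zero: "(\<Sum>x\<in>Or. \<Prod>y\<in>Y. x - y) = 0"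
    by (simp only: of_int_sum of_int_poly_root_poly)
  \<comment> \<open>Multiplication by \<open>h\<close> permutes \<open>Y\<close>, so
    \<open>h\<close> can be pulled out of every factor at the cost of \<open>h ^ card Y\<close>.
    Unless \<open>H = {1}\<close>, comparing the nonzero product of \<open>Y\<close> with that of
    its image shows that this power is \<open>1\<close>.\<close>
  have "(\<Prod>y\<in>Y. h * x\<^sub>0 - y) = (\<Prod>y\<in>Y. x\<^sub>0 - y)" if h: "h \<in> H" for h
  proof -
    have h0: "h \<noteq> 0" using h H by auto
    have "(*) h ` Y \<subseteq> Y"
    proof
      fix z assume "z \<in> (*) h ` Y"
      then obtain y where y: "y \<in> Y" "z = h * y" by auto
      have "h * y \<notin> Or"
      proof
        assume "h * y \<in> Or"
        then obtain k where "k \<in> H" "h * y = k * x\<^sub>0" by (auto simp: Or_def)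
        then have "y = (inverse h * k) * x\<^sub>0" using h0 by (simp add: field_simps)
        then show False using y H h \<open>k \<in> H\<close> by (auto simp: Y_def Or_def)
      qed
      then show "z \<in> Y" using y inv h by (auto simp: Y_def supp_def)
    qed
    moreover have injh: "inj_on ((*) h) Y" using h0 by (auto simp: inj_on_def)
    ultimately have img: "(*) h ` Y = Y" by (simp add: card_image card_subset_eq)
    have reindex: "(\<Prod>y\<in>Y. F (h * y)) = (\<Prod>y\<in>Y. F y)" for F :: "'p mod_ring \<Rightarrow> 'p mod_ring"
      using prod.reindex[OF injh, of F] img by (simp add: o_def)
    have hY: "h ^ card Y = 1"
    proof (cases "H = {1}")
      case False
      then have nz: "(\<Prod>y\<in>Y. y) \<noteq> 0" using free by (auto simp: Y_def supp_def)
      have "h ^ card Y * (\<Prod>y\<in>Y. y) = (\<Prod>y\<in>Y. y)"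
        using reindex[of "\<lambda>y. y"] by (simp add: prod.distrib)
      then show ?thesis using nz by simp
    qed (use h in auto)
    have "(\<Prod>y\<in>Y. h * x\<^sub>0 - y) = (\<Prod>y\<in>Y. h * x\<^sub>0 - h * y)" using reindex[of "\<lambda>y. h * x\<^sub>0 - y"] by simp
    also have "\<dots> = h ^ card Y * (\<Prod>y\<in>Y. x\<^sub>0 - y)"
      by (simp add: right_diff_distrib[symmetric] prod.distrib)
    finally show ?thesis using hY by simp
  qed
  then have "(\<Sum>x\<in>Or. \<Prod>y\<in>Y. x - y) = of_nat (card H) * (\<Prod>y\<in>Y. x\<^sub>0 - y)"
    unfolding Or_def by (subst sum.reindex[OF inj]) simp
  moreover have "(\<Prod>y\<in>Y. x\<^sub>0 - y) \<noteq> 0"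
  proof -
    have "x\<^sub>0 \<in> Or" using H(1) by (auto simp: Or_def intro!: image_eqI[of _ _ 1])
    then show ?thesis by (auto simp: Y_def)
  qed
  \<comment> \<open>The order of \<open>H\<close> is positive and below \<open>p\<close>.\<close>
  moreover have "of_nat (card H) \<noteq> (0 :: 'p mod_ring)"
  proof
    assume "of_nat (card H) = (0 :: 'p mod_ring)"
    then have "CARD('p) dvd card H" by (rule of_nat_0_mod_ring_dvd)
    moreover have "card H < CARD('p)"
      using psubset_card_mono[of UNIV H] H(2) by auto
    moreover have "card H > 0" using H(1) by (auto simp: card_gt_0_iff)
    ultimately show False using nat_dvd_not_less by blast
  qed
  ultimately show False using zero by simp
qed

text \<open>This is the case \<open>H = {1}\<close>, in which invariance and the condition at
  \<open>0\<close> hold for every function.\<close>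

lemma uncertainty:
  fixes f :: "'p::prime_card mod_ring \<Rightarrow> complex"
  assumes "f x \<noteq> 0"
  shows "card (supp f) + card (supp (fourier f)) \<ge> CARD('p) + 1"
proof -
  have "subgroup {1} (mult_grp :: 'p mod_ring monoid)"
  proof
    interpret G: group "mult_grp :: 'p mod_ring monoid"
      by (rule groupI) (auto simp: mult_grp_def intro!: bexI[of _ "inverse _"])
    have "\<one>\<^bsub>mult_grp\<^esub> = (1 :: 'p mod_ring)" by (simp add: mult_grp_def)
    then show "h \<in> {1} \<Longrightarrow> inv\<^bsub>mult_grp\<^esub> h \<in> {1}" for h :: "'p mod_ring" using G.inv_one by auto
  qed (auto simp: mult_grp_def)
  from uncertainty_invariant[OF this, of f x] show ?thesis using assms by simp
qed

section \<open>Prescribing supports\<close>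

text \<open>Gaussian elimination: an unknown \<open>k\<close> with nonzero coefficient in equation
  \<open>j\<close> is eliminated from the other equations and finally chosen so as to satisfy
  equation \<open>j\<close>.\<close>

lemma underdetermined_system:
  fixes M :: "'j \<Rightarrow> 'i \<Rightarrow> 'a::field"
  assumes "finite J" "finite I" "card J < card I"
  shows "\<exists>c. (\<exists>i\<in>I. c i \<noteq> 0) \<and> (\<forall>i. i \<notin> I \<longrightarrow> c i = 0) \<and> (\<forall>j\<in>J. (\<Sum>i\<in>I. M j i * c i) = 0)"
  using assms
proof (induction J arbitrary: I M rule: finite_induct)
  case empty
  then obtain k where "k \<in> I" by fastforce
  then show ?case by (intro exI[of _ "\<lambda>i. if i = k then 1 else 0"]) auto
next
  case (insert j J)
  show ?case
  proof (cases "\<forall>i\<in>I. M j i = 0")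
    case True
    have "card J < card I" using insert by simp
    from insert.IH[OF insert.prems(1) this] obtain c where
      "\<exists>i\<in>I. c i \<noteq> 0" "\<forall>i. i \<notin> I \<longrightarrow> c i = 0" "\<forall>j\<in>J. (\<Sum>i\<in>I. M j i * c i) = 0" by blast
    then show ?thesis using True by (intro exI[of _ c]) auto
  next
    case False
    then obtain k where k: "k \<in> I" "M j k \<noteq> 0" by auto
    let ?I = "I - {k}" and ?M = "\<lambda>j' i. M j' i - M j' k * M j i / M j k"
    have "card J < card ?I" "finite ?I" using insert k by auto
    from insert.IH[OF this(2,1), of ?M] obtain c where c: "\<exists>i\<in>?I. c i \<noteq> 0" "\<forall>i. i \<notin> ?I \<longrightarrow> c i = 0"
      "\<And>j'. j' \<in> J \<Longrightarrow> (\<Sum>i\<in>?I. ?M j' i * c i) = 0" by blast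
    define s where "s = (\<Sum>i\<in>?I. M j i * c i)"
    define d where "d = c(k := - s / M j k)"
    have sum_d: "(\<Sum>i\<in>I. M j' i * d i) = (\<Sum>i\<in>?I. M j' i * c i) - M j' k * s / M j k" for j'
    proof -
      have "(\<Sum>i\<in>I. M j' i * d i) = M j' k * d k + (\<Sum>i\<in>?I. M j' i * d i)"
        using insert.prems(1) k(1) by (rule sum.remove)
      also have "(\<Sum>i\<in>?I. M j' i * d i) = (\<Sum>i\<in>?I. M j' i * c i)"
        by (rule sum.cong) (auto simp: d_def)
      finally show ?thesis by (simp add: d_def)
    qed
    have "(\<Sum>i\<in>I. M j' i * d i) = 0" if "j' \<in> insert j J" for j'
    proof (cases "j' = j")
      case True
      then show ?thesis unfolding sum_d using k(2) by (simp add: s_def)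
    next
      case False
      then have "(\<Sum>i\<in>?I. ?M j' i * c i) = 0" using c(3) that by simp
      also have "(\<Sum>i\<in>?I. ?M j' i * c i) = (\<Sum>i\<in>?I. M j' i * c i) - M j' k * s / M j k"
        unfolding s_def sum_distrib_left sum_divide_distrib sum_subtractf[symmetric]
        by (rule sum.cong) (auto simp: algebra_simps)
      finally show ?thesis unfolding sum_d .
    qed
    moreover have "\<exists>i\<in>I. d i \<noteq> 0" using c(1) by (auto simp: d_def)
    moreover have "\<forall>i. i \<notin> I \<longrightarrow> d i = 0" using c(2) k by (auto simp: d_def)
    ultimately show ?thesis by blast
  qed
qed

text \<open>If \<open>v\<close> works for \<open>T\<close> and \<open>w\<close> for one more index,
  \<open>v + \<mu> w\<close> works for all of them once \<mu> avoids finitely many ratios. The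
  hypothesis \<open>comb\<close> asks only for such combinations, so no vector space structure on
  \<open>'v\<close> is involved.\<close>

lemma exists_generic_vector:
  fixes \<phi> :: "'t \<Rightarrow> 'v \<Rightarrow> 'a::field_char_0"
  assumes "finite T" "W \<noteq> {}" "\<And>t. t \<in> T \<Longrightarrow> \<exists>v\<in>W. \<phi> t v \<noteq> 0"
    and comb: "\<And>v w \<mu>. v \<in> W \<Longrightarrow> w \<in> W \<Longrightarrow> \<exists>u\<in>W. \<forall>t. \<phi> t u = \<phi> t v + \<mu> * \<phi> t w"
  shows "\<exists>v\<in>W. \<forall>t\<in>T. \<phi> t v \<noteq> 0"
  using assms(1,3)
proof (induction T rule: finite_induct)
  case (insert t T)
  then obtain v where v: "v \<in> W" "\<forall>s\<in>T. \<phi> s v \<noteq> 0" by auto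
  obtain w where w: "w \<in> W" "\<phi> t w \<noteq> 0" using insert by auto
  have "finite ((\<lambda>s. - \<phi> s v / \<phi> s w) ` insert t T)" using insert by simp
  then obtain \<mu> where l: "\<mu> \<notin> insert 0 ((\<lambda>s. - \<phi> s v / \<phi> s w) ` insert t T)"
    by (meson ex_new_if_finite finite.insertI infinite_UNIV_char_0)
  obtain u where u: "u \<in> W" "\<forall>s. \<phi> s u = \<phi> s v + \<mu> * \<phi> s w" using comb v w by blast
  have "\<phi> s u \<noteq> 0" if s: "s \<in> insert t T" for s
  proof (cases "\<phi> s w = 0")
    case True
    then show ?thesis using s v w u by auto
  next
    case False
    have "\<mu> \<noteq> - \<phi> s v / \<phi> s w" using l s by blast
    then show ?thesis using u(2) False by (auto simp: field_simps add_eq_0_iff)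
  qed
  then show ?case using u(1) by blast
qed (use assms(2) in auto)

lemma exists_exact_supports:
  fixes M :: "'j \<Rightarrow> 'i \<Rightarrow> 'a::field_char_0"
  assumes fin: "finite I" "finite J" and square: "card I = card J"
    and uncertainty: "\<And>c. \<exists>i\<in>I. c i \<noteq> 0 \<Longrightarrow>
      card I + 1 \<le> card {i \<in> I. c i \<noteq> 0} + card {j \<in> J. (\<Sum>i\<in>I. M j i * c i) \<noteq> 0}"
    and AB: "A \<subseteq> I" "B \<subseteq> J" "card I + 1 \<le> card A + card B"
  shows "\<exists>c. (\<forall>i\<in>I. c i \<noteq> 0 \<longleftrightarrow> i \<in> A) \<and> (\<forall>j\<in>J. (\<Sum>i\<in>I. M j i * c i) \<noteq> 0 \<longleftrightarrow> j \<in> B)"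
proof -
  let ?F = "\<lambda>c j. \<Sum>i\<in>I. M j i * c i"
  define W where "W A B = {c. (\<forall>i\<in>I - A. c i = 0) \<and> (\<forall>j\<in>J - B. ?F c j = 0)}" for A B
  have finAB: "finite A" "finite B" using AB fin finite_subset by blast+
  have cards: "card A \<le> card I" "card B \<le> card I" using AB fin square card_mono by metis+
  \<comment> \<open>Vanishing outside \<open>A'\<close> and \<open>B'\<close> leaves
    \<open>card A'\<close> unknowns and \<open>card A' - 1\<close> equations, hence a nonzero
    solution. The uncertainty hypothesis then excludes any further zero.\<close>
  have critical: "\<exists>c\<in>W A B. (\<forall>i\<in>A'. c i \<noteq> 0) \<and> (\<forall>j\<in>B'. ?F c j \<noteq> 0)"
    if sub: "A' \<subseteq> A" "B' \<subseteq> B" and crit: "card A' + card B' = card I + 1" for A' B'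
  proof -
    have sub': "A' \<subseteq> I" "B' \<subseteq> J" using sub AB by auto
    have fin': "finite A'" "finite B'" using sub' fin finite_subset by blast+
    have "card (J - B') = card J - card B'" using sub' fin' by (simp add: card_Diff_subset)
    then have "card (J - B') < card A'" using crit square card_mono[OF fin(2) sub'(2)] by linarith
    from underdetermined_system[OF _ fin'(1) this, of M] obtain c where
      c: "\<exists>i\<in>A'. c i \<noteq> 0" "\<forall>i. i \<notin> A' \<longrightarrow> c i = 0" "\<forall>j\<in>J - B'. (\<Sum>i\<in>A'. M j i * c i) = 0"
      using fin by auto
    have F: "?F c j = (\<Sum>i\<in>A'. M j i * c i)" for j
      by (rule sum.mono_neutral_right) (use fin sub' c(2) in auto)
    let ?S = "{i \<in> I. c i \<noteq> 0}" and ?T = "{j \<in> J. ?F c j \<noteq> 0}"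
    have "?S \<subseteq> A'" "?T \<subseteq> B'" using c(2,3) F by auto
    moreover have "card I + 1 \<le> card ?S + card ?T" using uncertainty[of c] c(1) sub' by blast
    ultimately have ST: "?S \<subseteq> A'" "?T \<subseteq> B'" "card A' \<le> card ?S" "card B' \<le> card ?T"
      using crit card_mono[OF fin'(1), of ?S] card_mono[OF fin'(2), of ?T] by linarith+
    have "?S = A'" by (rule card_seteq[OF fin'(1) ST(1,3)])
    moreover have "?T = B'" by (rule card_seteq[OF fin'(2) ST(2,4)])
    ultimately have "\<forall>i\<in>A'. c i \<noteq> 0" "\<forall>j\<in>B'. ?F c j \<noteq> 0"
      "\<forall>i\<in>I - A'. c i = 0" "\<forall>j\<in>J - B'. ?F c j = 0" by blast+
    then show ?thesis using sub unfolding W_def by (intro bexI[of _ c]) auto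
  qed
  have subset_with: "\<exists>A'. x \<in> A' \<and> A' \<subseteq> A \<and> card A' = n" if "x \<in> A" "1 \<le> n" "n \<le> card A" "finite A"
    for x and A :: "'b set" and n
  proof -
    have "n - 1 \<le> card (A - {x})" using that by simp
    then obtain D where D: "D \<subseteq> A - {x}" "card D = n - 1" "finite D" by (meson obtain_subset_with_card_n)
    then have "card (insert x D) = n" using that by (subst card_insert_disjoint) auto
    then show ?thesis using D that by (intro exI[of _ "insert x D"]) auto
  qed
  \<comment> \<open>The disjoint sum treats the entries of \<open>c\<close> and those of its image
    as one family of functionals.\<close>
  let ?\<phi> = "\<lambda>t c. case t of Inl i \<Rightarrow> c i | Inr j \<Rightarrow> ?F c j"
  have "\<exists>c\<in>W A B. \<forall>t\<in>A <+> B. ?\<phi> t c \<noteq> 0"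
  proof (rule exists_generic_vector)
    show "finite (A <+> B)" using finAB by simp
    have "(\<lambda>_. 0) \<in> W A B" unfolding W_def by simp
    then show "W A B \<noteq> {}" by blast
    show "\<exists>c\<in>W A B. ?\<phi> t c \<noteq> 0" if "t \<in> A <+> B" for t
    proof (cases t)
      case (Inl i)
      then have i: "i \<in> A" using that by auto
      \<comment> \<open>The set \<open>B\<close> is kept whole and \<open>A\<close> is shrunk around
        \<open>i\<close> to the critical size; the case of \<open>j\<close> is symmetric.\<close>
      then have "1 \<le> card I + 1 - card B" "card I + 1 - card B \<le> card A" using AB cards by auto
      then obtain A' where "i \<in> A'" "A' \<subseteq> A" "card A' = card I + 1 - card B"
        using subset_with[OF i] finAB by blast
      then show ?thesis using critical[of A' B] cards Inl by fastforce
    next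
      case (Inr j)
      then have j: "j \<in> B" using that by auto
      then have "1 \<le> card I + 1 - card A" "card I + 1 - card A \<le> card B" using AB cards by auto
      then obtain B' where "j \<in> B'" "B' \<subseteq> B" "card B' = card I + 1 - card A"
        using subset_with[OF j] finAB by blast
      then show ?thesis using critical[of A B'] cards Inr by fastforce
    qed
    fix v w \<mu> assume vw: "v \<in> W A B" "w \<in> W A B"
    let ?u = "\<lambda>i. v i + \<mu> * w i"
    have F: "?F ?u j = ?F v j + \<mu> * ?F w j" for j
      by (simp add: sum_distrib_left sum.distrib[symmetric] algebra_simps)
    have "?u \<in> W A B" using vw unfolding W_def mem_Collect_eq F by simp
    moreover have "\<forall>t. ?\<phi> t ?u = ?\<phi> t v + \<mu> * ?\<phi> t w" using F by (auto split: sum.split)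
    ultimately show "\<exists>u\<in>W A B. \<forall>t. ?\<phi> t u = ?\<phi> t v + \<mu> * ?\<phi> t w" by blast
  qed
  then obtain c where c: "c \<in> W A B" "\<And>t. t \<in> A <+> B \<Longrightarrow> ?\<phi> t c \<noteq> 0" by blast
  have "c i \<noteq> 0" if "i \<in> A" for i using c(2)[of "Inl i"] that by auto
  moreover have "?F c j \<noteq> 0" if "j \<in> B" for j using c(2)[of "Inr j"] that by auto
  ultimately show ?thesis using c(1) unfolding W_def by (intro exI[of _ c]) auto
qed

section \<open>Symmetric functions\<close>

lemma exp_eq_of_dvd:
  assumes "int p dvd k - l" "p > 0"
  shows "exp (- (2 * of_real pi * \<i> * of_int k / of_nat p)) = exp (- (2 * of_real pi * \<i> * of_int l / of_nat p))"
proof -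
  obtain m where "k - l = int p * m" using assms(1) by (rule dvdE)
  then have m: "k = l + int p * m" by simp
  have "- (2 * of_real pi * \<i> * of_int k / of_nat p)
      = - (2 * of_real pi * \<i> * of_int l / of_nat p) + \<i> * of_real (2 * pi * of_int (- m))"
    using assms(2) by (simp add: m add_divide_distrib distrib_left)
  moreover have "exp (\<i> * of_real (2 * pi * of_int (- m))) = 1"
    using cis_multiple_2pi[of "of_int (- m)"] by (simp add: cis_conv_exp)
  ultimately show ?thesis by (simp only: exp_add mult_1_right)
qed

locale character_setting =
  fixes H :: "'p::prime_card mod_ring set" and \<chi> :: "'p mod_ring \<Rightarrow> complex"
  assumes subgroup: "subgroup H mult_grp" and character: "is_character H \<chi>"
begin

lemmas H = subgroup_mult_grpD[OF subgroup]

lemma chi_mult: "g \<in> H \<Longrightarrow> h \<in> H \<Longrightarrow> \<chi> (g * h) = \<chi> g * \<chi> h"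
  using character by (simp add: is_character_def hom_def mult_grp_def)

lemma chi_nonzero: "h \<in> H \<Longrightarrow> \<chi> h \<noteq> 0"
  using character by (auto simp: is_character_def hom_def mult_grp_def Pi_def)

lemma chi_one: "\<chi> 1 = 1"
  using chi_mult[of 1 1] chi_nonzero[of 1] H(1) by simp

lemma nonzero: "h \<in> H \<Longrightarrow> h \<noteq> 0"
  using H(2) by auto

lemma inverse_mult_cancel: "h \<in> H \<Longrightarrow> inverse h * (h * x) = x"
  using nonzero[of h] by (simp add: mult.assoc[symmetric])

lemma supp_H_closed: "chi_symmetric H \<chi> f \<Longrightarrow> H_closed H (supp f)"
  by (auto simp: chi_symmetric_def H_closed_def supp_def chi_nonzero)

text \<open>The kernel depends only on the product of its arguments modulo \<open>p\<close>, so
  \<open>h\<close> moves from \<open>a\<close> to \<open>b\<close>. Substituting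
  \<open>inverse h * b\<close> for \<open>b\<close> brings in the inverse character.\<close>

lemma fourier_symmetric:
  assumes f: "chi_symmetric H \<chi> f" and h: "h \<in> H"
  shows "fourier f (h * a) = \<chi> (inverse h) * fourier f a"
proof -
  define K :: "'p mod_ring \<Rightarrow> 'p mod_ring \<Rightarrow> complex" where "K a b =
    exp (- (2 * of_real pi * \<i> * of_int (to_int_mod_ring a * to_int_mod_ring b) / of_nat CARD('p)))" for a b
  have K: "K (h * a) b = K a (h * b)" for b
    unfolding K_def
  proof (rule exp_eq_of_dvd)
    have "of_int (to_int_mod_ring (h * a) * to_int_mod_ring b - to_int_mod_ring a * to_int_mod_ring (h * b))
        = (0 :: 'p mod_ring)"
      by (simp add: of_int_to_int_mod_ring)
    then show "int CARD('p) dvd to_int_mod_ring (h * a) * to_int_mod_ring b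
        - to_int_mod_ring a * to_int_mod_ring (h * b)"
      by (simp only: of_int_mod_ring_eq_0_iff)
  qed simp
  have "fourier f (h * a) = (\<Sum>b\<in>UNIV. f b * K a (h * b))"
    by (simp only: fourier_def K_def[symmetric] K)
  also have "\<dots> = (\<Sum>b\<in>UNIV. f (inverse h * b) * K a b)"
    by (rule sum.reindex_bij_witness[of _ "\<lambda>b. inverse h * b" "\<lambda>b. h * b"])
      (use nonzero[OF h] in \<open>auto simp: field_simps\<close>)
  also have "\<dots> = \<chi> (inverse h) * fourier f a"
    using f H(4)[OF h] by (simp add: chi_symmetric_def fourier_def K_def sum_distrib_left mult.assoc)
  finally show ?thesis .
qed

lemma supp_fourier_H_closed: "chi_symmetric H \<chi> f \<Longrightarrow> H_closed H (supp (fourier f))"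
  by (auto simp: H_closed_def supp_def fourier_symmetric chi_nonzero H(4))

text \<open>The point \<open>0\<close> is fixed by \<open>H\<close>, so the symmetry under an
  \<open>h\<close> with \<open>\<chi> h \<noteq> 1\<close> forces the value \<open>0\<close>; the
  transform has the symmetry of the inverse character.\<close>

lemma chi_symmetric_zero:
  assumes "\<not> trivial_character H \<chi>" "chi_symmetric H \<chi> f"
  shows "f 0 = 0" "fourier f 0 = 0"
proof -
  obtain h where h: "h \<in> H" "\<chi> h \<noteq> 1" using assms(1) by (auto simp: trivial_character_def)
  have "f (h * 0) = \<chi> h * f 0" using assms(2) h(1) unfolding chi_symmetric_def by blast
  then show "f 0 = 0" using h(2) by simp
  have "h * inverse h = 1" using nonzero[OF h(1)] by simp
  then have "\<chi> h * \<chi> (inverse h) = 1" using chi_mult[OF h(1) H(4)[OF h(1)]] chi_one by simp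
  then have "\<chi> (inverse h) \<noteq> 1" using h(2) by auto
  then show "fourier f 0 = 0" using fourier_symmetric[OF assms(2) h(1), of 0] by simp
qed

text \<open>For \<open>u \<noteq> 0\<close> this is the symmetric function on the orbit of
  \<open>u\<close> with value \<open>\<chi> h\<close> at \<open>h * u\<close>. The sum also covers
  the fixed point \<open>u = 0\<close>, where all of \<open>H\<close> contributes.\<close>

definition orbit_function :: "'p mod_ring \<Rightarrow> 'p mod_ring \<Rightarrow> complex" where
  "orbit_function u x = sum \<chi> {h \<in> H. h * u = x}"

lemma chi_symmetric_orbit_function: "chi_symmetric H \<chi> (orbit_function u)"
  unfolding chi_symmetric_def
proof (intro ballI allI)
  fix g x assume g: "g \<in> H"
  have cancel: "g * (inverse g * z) = z" "inverse g * (g * z) = z" for z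
    using nonzero[OF g] by (simp_all add: mult.assoc[symmetric])
  have "orbit_function u (g * x) = (\<Sum>h\<in>{h \<in> H. h * u = x}. \<chi> (g * h))"
    unfolding orbit_function_def
    by (rule sum.reindex_bij_witness[of _ "\<lambda>h. g * h" "\<lambda>h. inverse g * h"])
      (use H(3,4) g in \<open>auto simp: mult.assoc cancel\<close>)
  also have "\<dots> = \<chi> g * orbit_function u x"
    using g by (simp add: orbit_function_def sum_distrib_left chi_mult)
  finally show "orbit_function u (g * x) = \<chi> g * orbit_function u x" .
qed

lemma orbit_function_outside: "(\<And>h. h \<in> H \<Longrightarrow> x \<noteq> h * u) \<Longrightarrow> orbit_function u x = 0"
  unfolding orbit_function_def by (rule sum.neutral) auto

lemma orbit_function_self:
  assumes "u = 0 \<Longrightarrow> trivial_character H \<chi>"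
  shows "orbit_function u u \<noteq> 0"
proof (cases "u = 0")
  case True
  then have "orbit_function u u = of_nat (card H)"
    using assms by (simp add: orbit_function_def trivial_character_def)
  moreover have "card H \<noteq> 0" using H(1) by auto
  ultimately show ?thesis by simp
next
  case False
  then have "{h \<in> H. h * u = u} = {1}" using H(1) by auto
  then show ?thesis by (simp add: orbit_function_def chi_one)
qed

end

section \<open>Representatives of the orbits of nonzero elements\<close>

locale orbit_transversal = character_setting H \<chi>
  for H :: "'p::prime_card mod_ring set" and \<chi> +
  fixes R :: "'p mod_ring set"
  assumes zero_notin: "0 \<notin> R"
    and covers: "\<And>x. x \<noteq> 0 \<Longrightarrow> \<exists>u\<in>R. \<exists>h\<in>H. x = h * u"
    and unique: "\<And>u v h. u \<in> R \<Longrightarrow> v \<in> R \<Longrightarrow> h \<in> H \<Longrightarrow> v = h * u \<Longrightarrow> u = v"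

lemma (in character_setting) exists_orbit_transversal: "\<exists>R. orbit_transversal H \<chi> R"
proof -
  define orb where "orb x = (\<lambda>h. h * x) ` H" for x
  \<comment> \<open>The choice depends only on the set \<open>orb x\<close>, so all points of one
    orbit receive the same representative.\<close>
  define rep where "rep x = (SOME y. y \<in> orb x)" for x
  have self: "x \<in> orb x" for x
    unfolding orb_def using H(1) by (rule rev_image_eqI) simp
  have rep: "rep x \<in> orb x" for x unfolding rep_def by (rule someI[of _ x]) (rule self)
  have orb_mult_subset: "orb (h * x) \<subseteq> orb x" if "h \<in> H" for h x
    unfolding orb_def
  proof (rule image_subsetI)
    fix g assume "g \<in> H"
    with \<open>h \<in> H\<close> have "g * h \<in> H" by (rule H(3)[rotated])
    then show "g * (h * x) \<in> (\<lambda>h. h * x) ` H" by (rule rev_image_eqI) (simp only: mult.assoc)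
  qed
  have orb_mult: "orb (h * x) = orb x" if "h \<in> H" for h x
  proof
    show "orb x \<subseteq> orb (h * x)"
      using orb_mult_subset[OF H(4)[OF that], of "h * x"] by (simp only: inverse_mult_cancel[OF that])
  qed (rule orb_mult_subset[OF that])
  have orb_rep: "orb (rep x) = orb x" for x
  proof -
    obtain h where "h \<in> H" "rep x = h * x" using rep[of x] unfolding orb_def by (rule imageE)
    then show ?thesis by (simp only: orb_mult)
  qed
  have "orbit_transversal H \<chi> (rep ` (- {0}))"
  proof (rule orbit_transversal.intro[OF character_setting_axioms], rule orbit_transversal_axioms.intro)
    show "0 \<notin> rep ` (- {0})"
    proof
      assume "0 \<in> rep ` (- {0})"
      then obtain x where x: "rep x = 0" "x \<noteq> 0" by (elim imageE) simp
      obtain h where "h \<in> H" "rep x = h * x" using rep[of x] unfolding orb_def by (rule imageE)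
      then show False using x nonzero[of h] by simp
    qed
    fix x :: "'p mod_ring" assume x: "x \<noteq> 0"
    have "x \<in> orb (rep x)" unfolding orb_rep by (rule self)
    then obtain h where "h \<in> H" "x = h * rep x" unfolding orb_def by (rule imageE)
    then have "\<exists>h\<in>H. x = h * rep x" by (intro bexI[of _ h])
    moreover have "rep x \<in> rep ` (- {0})" using x by (intro imageI) simp
    ultimately show "\<exists>u\<in>rep ` (- {0}). \<exists>h\<in>H. x = h * u" by (rule bexI)
  next
    fix u v h assume "u \<in> rep ` (- {0})" "v \<in> rep ` (- {0})" and h: "h \<in> H" "v = h * u"
    then obtain a b where ab: "u = rep a" "v = rep b" by (elim imageE)
    have "orb v = orb u" unfolding h(2) by (rule orb_mult[OF h(1)])
    then have "orb b = orb a" unfolding ab orb_rep .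
    then show "u = v" by (simp only: ab rep_def)
  qed
  then show ?thesis ..
qed

context orbit_transversal
begin

text \<open>\<open>H\<close> acts freely away from \<open>0\<close>, so a point of \<open>S\<close>
  is \<open>h * u\<close> for exactly one \<open>h\<close> and one representative
  \<open>u\<close>.\<close>

lemma card_H_closed:
  assumes S: "H_closed H S" "0 \<notin> S"
  shows "card S = card H * card (S \<inter> R)"
proof -
  have "bij_betw (\<lambda>(h, u). h * u) (H \<times> (S \<inter> R)) S"
    unfolding bij_betw_def
  proof
    show "inj_on (\<lambda>(h, u). h * u) (H \<times> (S \<inter> R))"
    proof (rule inj_onI, clarify)
      fix h u g v assume *: "h \<in> H" "g \<in> H" "u \<in> R" "v \<in> R" "h * u = g * v"
      have "v = (inverse g * h) * u"
        unfolding mult.assoc *(5) by (rule inverse_mult_cancel[OF *(2), symmetric])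
      then have "u = v" by (rule unique[OF *(3,4) H(3)[OF H(4)[OF *(2)] *(1)]])
      moreover have "u \<noteq> 0" using *(3) zero_notin by auto
      ultimately show "h = g \<and> u = v" using *(5) by simp
    qed
    show "(\<lambda>(h, u). h * u) ` (H \<times> (S \<inter> R)) = S"
    proof (intro equalityI subsetI)
      fix x assume x: "x \<in> S"
      then have "x \<noteq> 0" using S(2) by auto
      then obtain u h where u: "u \<in> R" "h \<in> H" "x = h * u" using covers by blast
      then have "u = inverse h * x" by (simp only: inverse_mult_cancel)
      moreover have "inverse h * x \<in> S" using S(1) x H(4)[OF u(2)] by (simp add: H_closed_def)
      ultimately have "u \<in> S" by simp
      then show "x \<in> (\<lambda>(h, u). h * u) ` (H \<times> (S \<inter> R))"
        using u by (intro image_eqI[of _ _ "(h, u)"]) simp_all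
    qed (use S in \<open>auto simp: H_closed_def\<close>)
  qed
  from bij_betw_same_card[OF this] show ?thesis by simp
qed

lemma H_closed_Diff_zero: "H_closed H S \<Longrightarrow> H_closed H (S - {0})"
  using nonzero by (auto simp: H_closed_def)

lemma H_closed_eqI:
  assumes "H_closed H S" "H_closed H T" "0 \<in> S \<longleftrightarrow> 0 \<in> T" "S \<inter> R = T \<inter> R"
  shows "S = T"
proof -
  have *: "S \<subseteq> T" if "H_closed H S" "H_closed H T" "0 \<in> S \<longleftrightarrow> 0 \<in> T" "S \<inter> R = T \<inter> R" for S T
  proof
    fix x assume x: "x \<in> S"
    show "x \<in> T"
    proof (cases "x = 0")
      case False
      then obtain u h where u: "u \<in> R" "h \<in> H" "x = h * u" using covers by blast
      then have "u = inverse h * x" by (simp only: inverse_mult_cancel)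
      moreover have "inverse h * x \<in> S" using that(1) x H(4)[OF u(2)] by (simp add: H_closed_def)
      ultimately have "u \<in> S" by simp
      then have "u \<in> T" using u(1) that(4) by blast
      then show ?thesis using u(2,3) that(2) by (simp add: H_closed_def)
    qed (use that x in auto)
  qed
  show ?thesis using *[of S T] *[of T S] assms by auto
qed

text \<open>The zero patterns of a symmetric function and its transform are determined on
  \<open>I\<close>, and the orbit functions turn the claim into the square system of
  \<open>exists_exact_supports\<close>. The point \<open>0\<close> belongs to \<open>I\<close> only
  for trivial \<chi>, since otherwise both functions vanish there.\<close>

lemma exists_function_with_supports:
  assumes I: "I = (if trivial_character H \<chi> then insert 0 R else R)"
    and uncertainty: "\<And>f x. chi_symmetric H \<chi> f \<Longrightarrow> f x \<noteq> 0 \<Longrightarrow>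
      card I + 1 \<le> card (supp f \<inter> I) + card (supp (fourier f) \<inter> I)"
    and AB: "H_closed H A" "H_closed H B" "\<not> trivial_character H \<chi> \<Longrightarrow> 0 \<notin> A \<and> 0 \<notin> B"
    and card: "card I + 1 \<le> card (A \<inter> I) + card (B \<inter> I)"
  shows "\<exists>f. chi_symmetric H \<chi> f \<and> supp f = A \<and> supp (fourier f) = B"
proof -
  define F :: "('p mod_ring \<Rightarrow> complex) \<Rightarrow> 'p mod_ring \<Rightarrow> complex" where "F c x = (\<Sum>u\<in>I. c u * orbit_function u x)" for c x
  define M where "M w u = fourier (orbit_function u) w" for w u
  have sym: "chi_symmetric H \<chi> (F c)" for c
    using chi_symmetric_orbit_function
    by (simp add: chi_symmetric_def F_def sum_distrib_left mult_ac)
  have fourier_F: "fourier (F c) w = (\<Sum>u\<in>I. M w u * c u)" for c w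
    unfolding fourier_def F_def M_def sum_distrib_right
    by (subst sum.swap) (simp add: mult_ac)
  have F_nz: "F c v \<noteq> 0 \<longleftrightarrow> c v \<noteq> 0" if v: "v \<in> I" for c v
  proof -
    have "orbit_function u v = 0" if "u \<in> I - {v}" for u
    proof (rule orbit_function_outside)
      fix h assume h: "h \<in> H"
      show "v \<noteq> h * u"
      proof (cases "u \<in> R \<and> v \<in> R")
        case True
        then show ?thesis using unique h that by auto
      next
        case False
        then have "u = 0 \<and> v \<noteq> 0 \<or> u \<noteq> 0 \<and> v = 0"
          using that v zero_notin I by (auto split: if_splits)
        then show ?thesis using nonzero[OF h] by auto
      qed
    qed
    then have "F c v = c v * orbit_function v v"
      unfolding F_def using v by (subst sum.remove[of _ v]) auto
    moreover have "orbit_function v v \<noteq> 0"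
      using v zero_notin I by (intro orbit_function_self) (auto split: if_splits)
    ultimately show ?thesis by simp
  qed
  have "\<exists>c. (\<forall>i\<in>I. c i \<noteq> 0 \<longleftrightarrow> i \<in> A \<inter> I) \<and> (\<forall>j\<in>I. (\<Sum>i\<in>I. M j i * c i) \<noteq> 0 \<longleftrightarrow> j \<in> B \<inter> I)"
  proof (rule exists_exact_supports[of I I M "A \<inter> I" "B \<inter> I"])
    fix c :: "'p mod_ring \<Rightarrow> complex"
    assume "\<exists>i\<in>I. c i \<noteq> 0"
    then obtain i where "F c i \<noteq> 0" using F_nz by blast
    moreover have "supp (F c) \<inter> I = {i \<in> I. c i \<noteq> 0}" using F_nz by (auto simp: supp_def)
    moreover have "supp (fourier (F c)) \<inter> I = {j \<in> I. (\<Sum>i\<in>I. M j i * c i) \<noteq> 0}"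
      by (auto simp: supp_def fourier_F)
    ultimately show "card I + 1 \<le> card {i \<in> I. c i \<noteq> 0} + card {j \<in> I. (\<Sum>i\<in>I. M j i * c i) \<noteq> 0}"
      using uncertainty[OF sym, of c] by auto
  qed (use card in auto)
  then obtain c where c: "\<And>i. i \<in> I \<Longrightarrow> c i \<noteq> 0 \<longleftrightarrow> i \<in> A"
    "\<And>j. j \<in> I \<Longrightarrow> fourier (F c) j \<noteq> 0 \<longleftrightarrow> j \<in> B"
    unfolding fourier_F by blast
  have cap: "supp (F c) \<inter> I = A \<inter> I" "supp (fourier (F c)) \<inter> I = B \<inter> I"
    using c F_nz by (auto simp: supp_def)
  have RI: "R \<subseteq> I" using I by auto
  have zero: "(0 \<in> supp (F c) \<longleftrightarrow> 0 \<in> A) \<and> (0 \<in> supp (fourier (F c)) \<longleftrightarrow> 0 \<in> B)"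
  proof (cases "trivial_character H \<chi>")
    case True
    then have "0 \<in> I" using I by simp
    then show ?thesis using cap by blast
  next
    case False
    then show ?thesis
      using chi_symmetric_zero[OF False sym] AB(3) by (simp add: supp_def)
  qed
  have "supp (F c) = A"
    by (rule H_closed_eqI[OF supp_H_closed[OF sym] AB(1) zero[THEN conjunct1]]) (use cap RI in blast)
  moreover have "supp (fourier (F c)) = B"
    by (rule H_closed_eqI[OF supp_fourier_H_closed[OF sym] AB(2) zero[THEN conjunct2]]) (use cap RI in blast)
  ultimately show ?thesis using sym by blast
qed

section \<open>Counting orbits for nontrivial and trivial characters\<close>

lemma CARD_eq: "CARD('p) = card H * card R + 1"
proof -
  have "H_closed H (- {0})" using nonzero by (auto simp: H_closed_def)
  from card_H_closed[OF this] have "card (- {0 :: 'p mod_ring}) = card H * card (- {0} \<inter> R)" by simp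
  moreover have "- {0} \<inter> R = R" using zero_notin by auto
  moreover have "card (- {0 :: 'p mod_ring}) = CARD('p) - 1" by (simp add: Compl_eq_Diff_UNIV card_Diff_subset)
  ultimately have "CARD('p) - 1 = card H * card R" by simp
  then show ?thesis using zero_less_card_finite[where 'a='p] by linarith
qed

lemma card_H_pos: "card H > 0"
  using H(1) by (auto simp: card_gt_0_iff)

text \<open>As \<open>p - 1\<close> is \<open>card H * card R\<close>, the hypothesis divided by
  \<open>card H\<close> is the required bound on orbits. For the supports, \<open>p + 1\<close>
  exceeds \<open>card H * card R\<close>, and divisibility by \<open>card H\<close> raises the orbit
  count to at least \<open>card R + 1\<close>.\<close>

lemma nontrivial_case:
  assumes nontriv: "\<not> trivial_character H \<chi>" and AB: "H_closed H A" "H_closed H B" "0 \<notin> A" "0 \<notin> B"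
    and card: "CARD('p) + card H - 1 \<le> card A + card B"
  shows "\<exists>f. chi_symmetric H \<chi> f \<and> supp f = A \<and> supp (fourier f) = B"
proof (rule exists_function_with_supports[of R])
  have "card H * (card R + 1) \<le> card H * (card (A \<inter> R) + card (B \<inter> R))"
    using card card_H_closed[OF AB(1,3)] card_H_closed[OF AB(2,4)] CARD_eq by (simp add: algebra_simps)
  then show "card R + 1 \<le> card (A \<inter> R) + card (B \<inter> R)" using card_H_pos by (simp only: nat_mult_le_cancel1)
  fix f x assume f: "chi_symmetric H \<chi> f" "f x \<noteq> 0"
  have "0 \<notin> supp f" "0 \<notin> supp (fourier f)" using chi_symmetric_zero[OF nontriv f(1)] by (auto simp: supp_def)
  note cards = card_H_closed[OF supp_H_closed[OF f(1)] this(1)]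
    card_H_closed[OF supp_fourier_H_closed[OF f(1)] this(2)]
  have "card H * card R < card H * (card (supp f \<inter> R) + card (supp (fourier f) \<inter> R))"
    using uncertainty[of f x, OF f(2)] CARD_eq cards by (simp add: algebra_simps)
  then show "card R + 1 \<le> card (supp f \<inter> R) + card (supp (fourier f) \<inter> R)" by simp
qed (use nontriv AB in auto)

lemma trivial_case:
  assumes triv: "trivial_character H \<chi>" and AB: "H_closed H A" "H_closed H B"
    and card: "(if 0 \<notin> A \<and> 0 \<notin> B then CARD('p) + 2 * card H - 1
      else if (0 \<in> A) \<noteq> (0 \<in> B) then CARD('p) + card H else CARD('p) + 1) \<le> card A + card B"
  shows "\<exists>f. chi_symmetric H \<chi> f \<and> supp f = A \<and> supp (fourier f) = B"
proof (rule exists_function_with_supports[of "insert 0 R"])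
  let ?I = "insert 0 R" and ?n = "card H" and ?r = "card R"
  have card_I: "card ?I = ?r + 1" using zero_notin by simp
  have card_closed: "card S = of_bool (0 \<in> S) + ?n * card (S \<inter> R)"
    "card (S \<inter> ?I) = of_bool (0 \<in> S) + card (S \<inter> R)" if "H_closed H S" for S
  proof -
    have "card (S - {0}) = ?n * card (S \<inter> R)"
    proof -
      have "(S - {0}) \<inter> R = S \<inter> R" using zero_notin by auto
      then show ?thesis using card_H_closed[OF H_closed_Diff_zero[OF that]] by simp
    qed
    moreover have "card S = of_bool (0 \<in> S) + card (S - {0})"
      using card.remove[of S 0] by (cases "0 \<in> S") simp_all
    ultimately show "card S = of_bool (0 \<in> S) + ?n * card (S \<inter> R)" by simp
    show "card (S \<inter> ?I) = of_bool (0 \<in> S) + card (S \<inter> R)"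
      using zero_notin by (cases "0 \<in> S") auto
  qed
  \<comment> \<open>This conversion from points to orbits serves both the prescribed sets and the
    supports of \<open>f\<close>. If \<open>0\<close> is in at most one set, the summand
    \<open>1\<close> in \<open>CARD_eq\<close> makes an inequality strict, which gains an orbit; if
    it is in both, the orbit \<open>{0}\<close> counts twice.\<close>
  have bound: "card ?I + 1 \<le> card (S \<inter> ?I) + card (T \<inter> ?I)"
    if ST: "H_closed H S" "H_closed H T"
      and le: "CARD('p) + (if 0 \<notin> S \<and> 0 \<notin> T then ?n else 1) \<le> card S + card T" for S T
  proof -
    let ?s = "card (S \<inter> R)" and ?t = "card (T \<inter> R)"
    note cards = card_closed[OF ST(1)] card_closed[OF ST(2)]
    consider "0 \<notin> S" "0 \<notin> T" | "(0 \<in> S) \<noteq> (0 \<in> T)" | "0 \<in> S" "0 \<in> T" by blast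
    then show ?thesis
    proof cases
      case 1
      then have "?n * (?r + 1) < ?n * (?s + ?t)" using le CARD_eq cards(1,3) by (simp add: distrib_left)
      then have "?r + 1 < ?s + ?t" by (simp only: mult_less_cancel1)
      then show ?thesis unfolding card_I cards(2,4) using 1 by simp
    next
      case 2
      then have "?n * ?r < ?n * (?s + ?t)" using le CARD_eq cards(1,3) by (auto simp: distrib_left)
      then have "?r < ?s + ?t" by (simp only: mult_less_cancel1)
      then show ?thesis unfolding card_I cards(2,4) using 2 by auto
    next
      case 3
      then have "?n * ?r \<le> ?n * (?s + ?t)" using le CARD_eq cards(1,3) by (simp add: distrib_left)
      then have "?r \<le> ?s + ?t" using card_H_pos by (simp only: nat_mult_le_cancel1)
      then show ?thesis unfolding card_I cards(2,4) using 3 by simp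
    qed
  qed
  show "card ?I + 1 \<le> card (A \<inter> ?I) + card (B \<inter> ?I)"
    by (rule bound[OF AB]) (use card card_H_pos in \<open>auto split: if_splits\<close>)
  fix f x assume f: "chi_symmetric H \<chi> f" "f x \<noteq> 0"
  show "card ?I + 1 \<le> card (supp f \<inter> ?I) + card (supp (fourier f) \<inter> ?I)"
  proof (rule bound[OF supp_H_closed[OF f(1)] supp_fourier_H_closed[OF f(1)]])
    have "f (h * y) = f y" if "h \<in> H" for h y
      using f(1) triv that by (simp add: chi_symmetric_def trivial_character_def)
    \<comment> \<open>The stronger bound requires \<open>f 0 = 0\<close>; when \<open>0\<close> lies
      in the support of \<open>f\<close>, the bound \<open>p + 1\<close> suffices.\<close>
    then have "CARD('p) + ?n \<le> card (supp f) + card (supp (fourier f))" if "0 \<notin> supp f"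
      using uncertainty_invariant[of H f x] subgroup f(2) that by (simp add: supp_def)
    then show "CARD('p) + (if 0 \<notin> supp f \<and> 0 \<notin> supp (fourier f) then ?n else 1)
        \<le> card (supp f) + card (supp (fourier f))"
      using uncertainty[of f x, OF f(2)] by simp
  qed
qed (use triv AB in auto)

end

theorem theorem1p9:
  fixes H :: "'p::prime_card mod_ring set"
    and \<chi> :: "'p mod_ring \<Rightarrow> complex"
  assumes "subgroup H mult_grp"
    and "is_character H \<chi>"
  shows
    "(\<not> trivial_character H \<chi> \<longrightarrow>
        (\<forall>A B. H_closed H A \<and> H_closed H B \<and> A \<subseteq> UNIV - {0} \<and> B \<subseteq> UNIV - {0} \<and>
           card A + card B \<ge> CARD('p) + card H - 1 \<longrightarrow>
           (\<exists>f. chi_symmetric H \<chi> f \<and> supp f = A \<and> supp (fourier f) = B))) \<and>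
     (trivial_character H \<chi> \<longrightarrow>
        (\<forall>A B. H_closed H A \<and> H_closed H B \<and>
           card A + card B \<ge>
             (if 0 \<notin> A \<and> 0 \<notin> B then CARD('p) + 2 * card H - 1
              else if (0 \<in> A) \<noteq> (0 \<in> B) then CARD('p) + card H
              else CARD('p) + 1) \<longrightarrow>
           (\<exists>f. chi_symmetric H \<chi> f \<and> supp f = A \<and> supp (fourier f) = B)))"
proof -
  interpret character_setting H \<chi> by (rule character_setting.intro) (fact assms)+
  obtain R where "orbit_transversal H \<chi> R" using exists_orbit_transversal ..
  then interpret orbit_transversal H \<chi> R .
  show ?thesis
  proof (intro conjI impI allI; elim conjE)
    fix A B
    assume "\<not> trivial_character H \<chi>" "H_closed H A" "H_closed H B" "A \<subseteq> UNIV - {0}" "B \<subseteq> UNIV - {0}"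
      "CARD('p) + card H - 1 \<le> card A + card B"
    then show "\<exists>f. chi_symmetric H \<chi> f \<and> supp f = A \<and> supp (fourier f) = B"
      by (intro nontrivial_case) auto
  qed (rule trivial_case)
qed

end
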